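(* Let $q\in(0,1)$. The multiplication in $\mathrm{Pol}(\mathbb{C})_q[[t]]$ given by the bilinear map $$m:\mathrm{Pol}(\mathbb{C})_q[[t]]\times\mathrm{Pol}(\mathbb{C})_q[[t]]\to\mathrm{Pol}(\mathbb{C})_q[[t]],\qquad m:\ \sum_{j=0}^\infty a_jt^j\times\sum_{k=0}^\infty b_kt^k\ \mapsto\ \sum_{i=0}^\infty\Big(\sum_{j+k=i}a_j*b_k\Big)t^i,$$ with $a_j,b_k\in\mathrm{Pol}(\mathbb{C})_q$ for $j,k\in\mathbb{Z}_+$, is associative.
   Context: The ground field is $\mathbb{C}$, $q\in(0,1)$, $\mathbb{Z}_+=\{0,1,2,\dots\}$, and $(a;q^2)_k=(1-a)(1-q^2a)\cdots(1-q^{2(k-1)}a)$ (empty product equal to $1$). $\mathrm{Pol}(\mathbb{C})_q$ is the unital algebra with two generators $z,z^*$ and the single relation $z^*z=q^2zz^*+1-q^2$; the elements $\{z^jz^{*k}\}_{j,k\in\mathbb{Z}_+}$ form a basis of it. **Differential calculus.** $\Omega^1(\mathbb{C})_q$ is the first order differential calculus over $\mathrm{Pol}(\mathbb{C})_q$: a bimodule with a linear map $d:\mathrm{Pol}(\mathbb{C})_q\to\Omega^1(\mathbb{C})_q$ satisfying the Leibniz rule $d(f_1f_2)=df_1\cdot f_2+f_1\cdot df_2$, spanned by the elements $f_1\cdot df_2\cdot f_3$, and described by the commutation relations $$z\,dz=q^{-2}dz\,z,\quad z^*dz^*=q^2dz^*\,z^*,\quad z^*dz=q^2dz\,z^*,\quad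 z\,dz^*=q^{-2}dz^*\,z.$$ The partial derivatives are the linear operators in $\mathrm{Pol}(\mathbb{C})_q$ given by $$df=\frac{\partial^{(r)}f}{\partial z}dz+\frac{\partial^{(r)}f}{\partial z^*}dz^*=dz\frac{\partial^{(l)}f}{\partial z}+dz^*\frac{\partial^{(l)}f}{\partial z^*}.$$ **The $*$-product.** $m_0:\mathrm{Pol}(\mathbb{C})_q^{\otimes2}\to\mathrm{Pol}(\mathbb{C})_q$ is $m_0(f_1\otimes f_2)=f_1f_2$, and $\widetilde\square:\mathrm{Pol}(\mathbb{C})_q^{\otimes2}\to\mathrm{Pol}(\mathbb{C})_q^{\otimes2}$ is the linear operator $$\widetilde\square(f_1\otimes f_2)=\Big(\frac{\partial^{(r)}f_1}{\partial z^*}\otimes1\Big)\cdot q^{-2}\big(1-(1+q^{-2})z^*\otimes z+q^{-2}z^{*2}\otimes z^2\big)\cdot\Big(1\otimes\frac{\partial^{(l)}f_2}{\partial z}\Big),$$ with products taken in the ordinary (componentwise) tensor product algebra. For $k\in\mathbb{Z}_+$ put $$p_k(x)=\sum_{j=0}^k\frac{(q^{-2k};q^2)_j}{(q^2;q^2)_j^2}\,q^{2j}\prod_{i=0}^{j-1}\Big(1-q^{2i}\big((1-q^2)^2x+1+q^2\big)+q^{4i+2}\Big).$$ For $f_1,f_2\in\mathrm{Pol}(\mathbb{C})_q$, $$f_1*f_2=f_1\cdot f_2+\sum_{k=1}^\infty C_k(f_1,f_2)t^k\in\mathrm{Pol}(\mathbb{C})_q[[t]],\qquad C_k(f_1,f_2)=m_0\Big(\big(p_k(\widetilde\square)-p_{k-1}(\widetilde\square)\big)(f_1\otimes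 f_2)\Big).$$ The outer sum over $i$ in the definition of $m$ converges in the $t$-adic sense, since each $a_j*b_k$ is a formal power series in $t$ with coefficients in $\mathrm{Pol}(\mathbb{C})_q$. *)

theory Defs
  imports
    Complex_Main
    "HOL-Library.Poly_Mapping"
    "HOL-Library.Product_Plus"
    "HOL-Computational_Algebra.Polynomial"
    "HOL-Computational_Algebra.Formal_Power_Series"
begin

unbundle fps_syntax

section \<open>Complex vector spaces with a distinguished basis\<close>

definition scl :: "complex \<Rightarrow> ('a \<Rightarrow>\<^sub>0 complex) \<Rightarrow> ('a \<Rightarrow>\<^sub>0 complex)" where
  "scl c f = Poly_Mapping.map ((*) c) f"

text \<open>Linear extension of a map given on the basis, into a vector space with scaling \<open>s\<close>.\<close>
definition lin_ext :: "(complex \<Rightarrow> 'b \<Rightarrow> 'b) \<Rightarrow> ('a \<Rightarrow> 'b) \<Rightarrow> ('a \<Rightarrow>\<^sub>0 complex) \<Rightarrow> 'b::ab_group_add" where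
  "lin_ext s b f = (\<Sum>k\<in>Poly_Mapping.keys f. s (Poly_Mapping.lookup f k) (b k))"

abbreviation bas :: "'a \<Rightarrow> ('a \<Rightarrow>\<^sub>0 complex)" where
  "bas k \<equiv> Poly_Mapping.single k 1"

lemma lookup_scl [simp]: "Poly_Mapping.lookup (scl c f) k = c * Poly_Mapping.lookup f k"
  unfolding scl_def by (transfer) (auto simp: when_def)

lemma vector_space_scl: "vector_space (scl :: complex \<Rightarrow> ('a \<Rightarrow>\<^sub>0 complex) \<Rightarrow> _)"
  by unfold_locales (auto intro!: poly_mapping_eqI simp: lookup_add algebra_simps)

lemma scl_single [simp]: "scl c (Poly_Mapping.single k x) = Poly_Mapping.single k (c * x)"
  by (rule poly_mapping_eqI) (auto simp: lookup_single when_def)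

lemma lin_ext_sum:
  assumes "vector_space s" "finite A" "Poly_Mapping.keys f \<subseteq> A"
  shows "lin_ext s b f = (\<Sum>k\<in>A. s (Poly_Mapping.lookup f k) (b k))"
proof -
  interpret vector_space s by fact
  show ?thesis unfolding lin_ext_def
    by (rule sum.mono_neutral_left) (use assms in \<open>auto simp: in_keys_iff\<close>)
qed

lemma lin_alg_I:
  assumes "vector_space s" "\<And>x y. f (x + y) = f x + f y" "\<And>c x. f (scl c x) = s c (f x)"
  shows "Vector_Spaces.linear scl s f"
  using assms vector_space_scl by (auto simp: Vector_Spaces.linear_iff)

lemma lin_ext_linear:
  fixes b :: "'a \<Rightarrow> 'b::ab_group_add"
  assumes "vector_space s"
  shows "Vector_Spaces.linear scl s (lin_ext s b)"
proof -
  interpret vector_space s by fact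
  show ?thesis
  proof (rule lin_alg_I[OF assms])
    fix f g :: "'a \<Rightarrow>\<^sub>0 complex"
    let ?A = "Poly_Mapping.keys f \<union> Poly_Mapping.keys g"
    have "Poly_Mapping.keys (f + g) \<subseteq> ?A" by (rule keys_add)
    then show "lin_ext s b (f + g) = lin_ext s b f + lin_ext s b g"
      using assms by (simp add: lin_ext_sum[where A = ?A] lookup_add scale_left_distrib sum.distrib)
  next
    fix c and f :: "'a \<Rightarrow>\<^sub>0 complex"
    have "Poly_Mapping.keys (scl c f) \<subseteq> Poly_Mapping.keys f"
      by (auto simp: in_keys_iff)
    then show "lin_ext s b (scl c f) = s c (lin_ext s b f)"
      using assms by (simp add: lin_ext_sum[where A = "Poly_Mapping.keys f"] scale_sum_right)
  qed
qed

lemma lin_ext_single: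
  assumes "vector_space s"
  shows "lin_ext s b (Poly_Mapping.single k c) = s c (b k)"
proof -
  interpret vector_space s by fact
  show ?thesis by (simp add: lin_ext_sum[OF assms, where A = "{k}"])
qed

lemma lin_ext_bas [simp]:
  assumes "vector_space s"
  shows "lin_ext s b (bas k) = b k"
proof -
  interpret vector_space s by fact
  show ?thesis by (simp add: lin_ext_single[OF assms])
qed

lemma expand_bas: "f = (\<Sum>k\<in>Poly_Mapping.keys f. scl (Poly_Mapping.lookup f k) (bas k))"
proof (rule poly_mapping_eqI)
  fix k
  have "Poly_Mapping.lookup (\<Sum>k\<in>Poly_Mapping.keys f. scl (Poly_Mapping.lookup f k) (bas k)) k
      = (\<Sum>j\<in>Poly_Mapping.keys f. if j = k then Poly_Mapping.lookup f k else 0)"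
    by (auto simp: lookup_sum lookup_single when_def intro!: sum.cong)
  then show "Poly_Mapping.lookup f k = Poly_Mapping.lookup (\<Sum>k\<in>Poly_Mapping.keys f. scl (Poly_Mapping.lookup f k) (bas k)) k"
    by (simp add: in_keys_iff)
qed

lemma linear_ext_bas:
  assumes "Vector_Spaces.linear scl s f" "Vector_Spaces.linear scl s g" "\<And>k. f (bas k) = g (bas k)"
  shows "f = g"
proof
  fix x
  interpret f: Vector_Spaces.linear scl s f by fact
  interpret g: Vector_Spaces.linear scl s g by fact
  show "f x = g x"
    by (subst (1 2) expand_bas) (simp add: f.sum f.scale g.sum g.scale assms(3) del: scl_single)
qed

abbreviation lin :: "(('a \<Rightarrow>\<^sub>0 complex) \<Rightarrow> ('b \<Rightarrow>\<^sub>0 complex)) \<Rightarrow> bool" where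
  "lin \<equiv> Vector_Spaces.linear scl scl"

lemma lin_lin_ext: "lin (lin_ext scl b)"
  by (rule lin_ext_linear[OF vector_space_scl])

lemma lin_ext_scl_bas [simp]: "lin_ext scl b (bas k) = b k"
  by (rule lin_ext_bas[OF vector_space_scl])

lemma linI:
  assumes "\<And>x y. f (x + y) = f x + f y" "\<And>c x. f (scl c x) = scl c (f x)"
  shows "lin f"
  by (rule lin_alg_I[OF vector_space_scl]) (use assms in auto)

lemma lin_add: "lin f \<Longrightarrow> f (x + y) = f x + f y"
  by (simp add: Vector_Spaces.linear_iff)

lemma lin_scl: "lin f \<Longrightarrow> f (scl c x) = scl c (f x)"
  by (simp add: Vector_Spaces.linear_iff)

lemma scl_rules:
  "scl a (x + y) = scl a x + scl a y"
  "scl (a + b) x = scl a x + scl b x"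
  "scl a (scl b x) = scl (a * b) x"
  "scl 1 x = x" "scl 0 x = 0" "scl a 0 = 0"
  by (auto intro!: poly_mapping_eqI simp: lookup_add algebra_simps)

lemma lin_comp: "lin f \<Longrightarrow> lin g \<Longrightarrow> lin (\<lambda>x. f (g x))"
  by (rule linI) (simp_all add: lin_add lin_scl)

lemma lin_id: "lin (\<lambda>x. x)"
  by (rule linI) simp_all

lemma lin_plus: "lin f \<Longrightarrow> lin g \<Longrightarrow> lin (\<lambda>x. f x + g x)"
  by (rule linI) (simp_all add: lin_add lin_scl scl_rules)

lemma lin_scale: "lin f \<Longrightarrow> lin (\<lambda>x. scl c (f x))"
  by (rule linI) (simp_all add: lin_add lin_scl scl_rules mult.commute)

lemma lin_funpow:
  fixes f :: "('a \<Rightarrow>\<^sub>0 complex) \<Rightarrow> ('a \<Rightarrow>\<^sub>0 complex)"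
  shows "lin f \<Longrightarrow> lin (f ^^ n)"
proof (induction n)
  case 0 show ?case using lin_id by (simp add: id_def)
next
  case (Suc n) then show ?case by (simp add: comp_def lin_comp)
qed

lemma lin_eqI: "lin f \<Longrightarrow> lin g \<Longrightarrow> (\<And>k. f (bas k) = g (bas k)) \<Longrightarrow> f x = g x"
  by (metis linear_ext_bas)

lemma lin_ext_arg_lin:
  assumes "\<And>k. lin (\<lambda>g. b g k)"
  shows "lin (\<lambda>g. lin_ext scl (b g) f)"
proof (rule linI)
  fix x y
  show "lin_ext scl (b (x + y)) f = lin_ext scl (b x) f + lin_ext scl (b y) f"
    unfolding lin_ext_def
    by (simp add: lin_add[OF assms] scl_rules sum.distrib)
next
  fix c x
  interpret V: vector_space scl by (rule vector_space_scl)
  show "lin_ext scl (b (scl c x)) f = scl c (lin_ext scl (b x) f)"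
    unfolding lin_ext_def
    by (simp add: lin_scl[OF assms] V.scale_sum_right scl_rules mult.commute)
qed


section \<open>The algebra \<open>Pol(\<complex>)\<^sub>q\<close>\<close>

text \<open>
  An element is stored through its coefficients in the basis \<open>z\<^sup>j z\<^sup>*\<^sup>k\<close>, indexed by \<open>(j, k)\<close>.
  Note that the library multiplication \<open>*\<close> on this type is the commutative convolution product;
  the product of \<open>Pol(\<complex>)\<^sub>q\<close> is \<open>pmul q\<close>.
  The lemmas below show that the algebra so obtained has the defining presentation:
  it is associative and unital, the defining relation holds, and it is universal among the
  algebras with two elements satisfying this relation.
\<close>
type_synonym pol = "nat \<times> nat \<Rightarrow>\<^sub>0 complex"

abbreviation mon :: "nat \<Rightarrow> nat \<Rightarrow> pol" where
  "mon j k \<equiv> bas (j, k)"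

definition pone :: pol where "pone = mon 0 0"
definition gen_z :: pol where "gen_z = mon 1 0"
definition gen_zs :: pol where "gen_zs = mon 0 1"

text \<open>
  Left multiplication by \<open>z\<close> and \<open>z\<^sup>*\<close>; the latter is dictated by
  \<open>z\<^sup>* z\<^sup>j = q\<^sup>2\<^sup>j z\<^sup>j z\<^sup>* + (1 - q\<^sup>2\<^sup>j) z\<^sup>j\<^sup>-\<^sup>1\<close>,
  where the last summand vanishes for \<open>j = 0\<close>.
\<close>
definition lmul_z :: "pol \<Rightarrow> pol" where
  "lmul_z = lin_ext scl (\<lambda>(j, k). mon (Suc j) k)"

definition lmul_zs :: "real \<Rightarrow> pol \<Rightarrow> pol" where
  "lmul_zs q = lin_ext scl (\<lambda>(j, k).
     scl (of_real (q ^ (2 * j))) (mon j (Suc k)) + scl (of_real (1 - q ^ (2 * j))) (mon (j - 1) k))"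

definition pmul :: "real \<Rightarrow> pol \<Rightarrow> pol \<Rightarrow> pol" where
  "pmul q f g = lin_ext scl (\<lambda>(j, k). (lmul_z ^^ j) ((lmul_zs q ^^ k) g)) f"

lemma lin_lmul_z: "lin lmul_z" and lin_lmul_zs: "lin (lmul_zs q)"
  unfolding lmul_z_def lmul_zs_def by (rule lin_lin_ext)+

lemma lin_pmul_left: "lin (\<lambda>f. pmul q f g)"
  unfolding pmul_def by (rule lin_lin_ext)

lemma lin_pmul_right: "lin (pmul q f)"
proof -
  have "lin (\<lambda>g. pmul q f g)"
    unfolding pmul_def
    by (rule lin_ext_arg_lin)
       (auto simp: case_prod_beta intro!: lin_comp[OF lin_funpow lin_funpow] lin_lmul_z lin_lmul_zs)
  then show ?thesis .
qed

lemmas pmul_lin =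
  lin_add[OF lin_pmul_left] lin_scl[OF lin_pmul_left] lin_add[OF lin_pmul_right] lin_scl[OF lin_pmul_right]

lemma pmul_mon: "pmul q (mon j k) g = (lmul_z ^^ j) ((lmul_zs q ^^ k) g)"
  by (simp add: pmul_def)

lemma pmul_gen_z: "pmul q gen_z g = lmul_z g" and pmul_gen_zs: "pmul q gen_zs g = lmul_zs q g"
  by (simp_all add: gen_z_def gen_zs_def pmul_mon)

lemma lmul_z_mon: "lmul_z (mon j k) = mon (Suc j) k"
  by (simp add: lmul_z_def)

lemma lmul_zs_mon: "lmul_zs q (mon j k) =
  scl (of_real (q ^ (2 * j))) (mon j (Suc k)) + scl (of_real (1 - q ^ (2 * j))) (mon (j - 1) k)"
  by (simp add: lmul_zs_def del: scl_single)

lemma lmul_z_pow: "(lmul_z ^^ n) (mon j k) = mon (n + j) k"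
  by (induction n) (simp_all add: lmul_z_mon)

lemma lmul_zs_pow: "(lmul_zs q ^^ n) (mon 0 k) = mon 0 (n + k)"
  by (induction n) (simp_all add: lmul_zs_mon)

lemma lmul_rel: "lmul_zs q (lmul_z g) = scl (of_real (q\<^sup>2)) (lmul_z (lmul_zs q g)) + scl (of_real (1 - q\<^sup>2)) g"
proof (rule lin_eqI[where f = "\<lambda>g. lmul_zs q (lmul_z g)"])
  fix k :: "nat \<times> nat"
  obtain a b where k: "k = (a, b)" by (cases k)
  show "lmul_zs q (lmul_z (bas k)) = scl (of_real (q\<^sup>2)) (lmul_z (lmul_zs q (bas k))) + scl (of_real (1 - q\<^sup>2)) (bas k)"
    unfolding k
    by (cases a)
       (auto simp: lmul_z_mon lmul_zs_mon lin_add[OF lin_lmul_z] lin_scl[OF lin_lmul_z] scl_rules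
          lookup_add lookup_single when_def algebra_simps power2_eq_square
          simp del: scl_single intro!: poly_mapping_eqI)
qed (rule lin_plus lin_scale lin_comp[OF lin_lmul_z lin_lmul_zs] lin_comp[OF lin_lmul_zs lin_lmul_z] lin_id)+

lemma pmul_lmul_z: "pmul q (lmul_z f) g = lmul_z (pmul q f g)"
  by (rule lin_eqI[where f = "\<lambda>f. pmul q (lmul_z f) g"])
     (auto simp: lmul_z_mon pmul_mon intro!: lin_comp[OF lin_pmul_left] lin_lmul_z
        lin_comp[OF lin_lmul_z] lin_pmul_left)

lemma lmul_zs_z_pow: "lmul_zs q ((lmul_z ^^ j) g) =
  scl (of_real (q ^ (2 * j))) ((lmul_z ^^ j) (lmul_zs q g)) + scl (of_real (1 - q ^ (2 * j))) ((lmul_z ^^ (j - 1)) g)"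
proof (induction j)
  case 0 show ?case by (simp add: scl_rules)
next
  case (Suc j)
  let ?c = "\<lambda>x::real. complex_of_real x"
  have *: "scl (?c (q\<^sup>2)) (scl (?c (1 - q ^ (2 * j))) (lmul_z ((lmul_z ^^ (j - 1)) g)))
      = scl (?c (q\<^sup>2 * (1 - q ^ (2 * j)))) ((lmul_z ^^ j) g)"
    by (cases j) (simp_all add: scl_rules)
  have "lmul_zs q ((lmul_z ^^ Suc j) g) =
     scl (?c (q\<^sup>2)) (lmul_z (lmul_zs q ((lmul_z ^^ j) g))) + scl (?c (1 - q\<^sup>2)) ((lmul_z ^^ j) g)"
    by (simp add: lmul_rel)
  also have "\<dots> = scl (?c (q\<^sup>2)) (scl (?c (q ^ (2 * j))) (lmul_z ((lmul_z ^^ j) (lmul_zs q g))))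
      + scl (?c (q\<^sup>2 * (1 - q ^ (2 * j)))) ((lmul_z ^^ j) g) + scl (?c (1 - q\<^sup>2)) ((lmul_z ^^ j) g)"
    by (simp only: Suc.IH lin_add[OF lin_lmul_z] lin_scl[OF lin_lmul_z] scl_rules(1) *)
  also have "\<dots> = scl (?c (q ^ (2 * Suc j))) ((lmul_z ^^ Suc j) (lmul_zs q g))
      + scl (?c (q\<^sup>2 * (1 - q ^ (2 * j))) + ?c (1 - q\<^sup>2)) ((lmul_z ^^ j) g)"
    by (simp add: scl_rules power2_eq_square mult.assoc del: of_real_mult of_real_diff of_real_power)
       (simp add: power_add scl_rules mult_ac)
  also have "?c (q\<^sup>2 * (1 - q ^ (2 * j))) + ?c (1 - q\<^sup>2) = ?c (1 - q ^ (2 * Suc j))"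
    by (simp add: algebra_simps power2_eq_square)
  finally show ?case by simp
qed

lemma pmul_lmul_zs: "pmul q (lmul_zs q f) g = lmul_zs q (pmul q f g)"
proof (rule lin_eqI[where f = "\<lambda>f. pmul q (lmul_zs q f) g"])
  fix k :: "nat \<times> nat"
  obtain a b where k: "k = (a, b)" by (cases k)
  show "pmul q (lmul_zs q (bas k)) g = lmul_zs q (pmul q (bas k) g)"
    unfolding k by (simp add: lmul_zs_mon pmul_lin pmul_mon lmul_zs_z_pow del: scl_single)
qed (auto intro!: lin_comp[OF lin_pmul_left] lin_lmul_zs lin_comp[OF lin_lmul_zs] lin_pmul_left)

theorem pmul_assoc: "pmul q (pmul q f g) h = pmul q f (pmul q g h)"
proof (rule lin_eqI[where f = "\<lambda>f. pmul q (pmul q f g) h"])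
  fix k :: "nat \<times> nat"
  obtain a b where k: "k = (a, b)" by (cases k)
  have 1: "pmul q ((lmul_zs q ^^ b) g) h = (lmul_zs q ^^ b) (pmul q g h)"
    by (induction b) (simp_all add: pmul_lmul_zs)
  have "pmul q ((lmul_z ^^ a) g) h = (lmul_z ^^ a) (pmul q g h)" for g
    by (induction a) (simp_all add: pmul_lmul_z)
  then show "pmul q (pmul q (bas k) g) h = pmul q (bas k) (pmul q g h)"
    by (simp add: k pmul_mon 1)
qed (auto intro!: lin_comp[OF lin_pmul_left] lin_pmul_left)

theorem pmul_pone [simp]: "pmul q pone f = f" "pmul q f pone = f"
proof -
  show "pmul q pone f = f" by (simp add: pone_def pmul_mon)
  show "pmul q f pone = f"
    by (rule lin_eqI[where f = "\<lambda>f. pmul q f pone"])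
       (auto simp: pone_def pmul_mon lmul_zs_pow lmul_z_pow intro!: lin_pmul_left lin_id)
qed

theorem pmul_relation:
  "pmul q gen_zs gen_z = scl (of_real (q\<^sup>2)) (pmul q gen_z gen_zs) + scl (of_real (1 - q\<^sup>2)) pone"
  by (metis lmul_rel pmul_gen_z pmul_gen_zs pmul_pone(2))

theorem mon_eq: "mon j k = (pmul q gen_z ^^ j) ((pmul q gen_zs ^^ k) pone)"
proof -
  have "pmul q gen_z = lmul_z" "pmul q gen_zs = lmul_zs q"
    by (rule ext, rule pmul_gen_z, rule ext, rule pmul_gen_zs)
  then show ?thesis by (simp add: pone_def lmul_zs_pow lmul_z_pow)
qed

theorem pol_universal:
  fixes s :: "complex \<Rightarrow> 'b \<Rightarrow> 'b::ring_1"
  assumes "vector_space s"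
    and s1: "\<And>c x y. s c x * y = s c (x * y)" and s2: "\<And>c x y. x * s c y = s c (x * y)"
    and rel: "v * u = s (of_real (q\<^sup>2)) (u * v) + s (of_real (1 - q\<^sup>2)) 1"
  shows "\<exists>!\<phi>. Vector_Spaces.linear scl s \<phi> \<and> \<phi> pone = 1 \<and>
           (\<forall>f g. \<phi> (pmul q f g) = \<phi> f * \<phi> g) \<and> \<phi> gen_z = u \<and> \<phi> gen_zs = v"
proof -
  interpret vector_space s by fact
  define \<phi> where "\<phi> = lin_ext s (\<lambda>(j, k). u ^ j * v ^ k)"
  have L: "Vector_Spaces.linear scl s \<phi>"
    unfolding \<phi>_def by (rule lin_ext_linear) fact
  interpret L: Vector_Spaces.linear scl s \<phi> by (rule L)
  have mon: "\<phi> (mon j k) = u ^ j * v ^ k" for j k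
    unfolding \<phi>_def by (simp add: \<open>vector_space s\<close>)
  have comp1: "Vector_Spaces.linear scl s (\<lambda>f. \<phi> (T f))" if "lin T" for T :: "pol \<Rightarrow> pol"
    by (rule lin_alg_I[OF assms(1)]) (simp_all add: lin_add[OF that] lin_scl[OF that] L.add L.scale)
  have comp2: "Vector_Spaces.linear scl s (\<lambda>f. w * \<phi> f)" for w
    by (rule lin_alg_I[OF assms(1)]) (simp_all add: L.add L.scale s2 distrib_left)
  have comp3: "Vector_Spaces.linear scl s (\<lambda>f. \<phi> f * w)" for w
    by (rule lin_alg_I[OF assms(1)]) (simp_all add: L.add L.scale s1 distrib_right)
  have "(\<lambda>f. \<phi> (lmul_z f)) = (\<lambda>f. u * \<phi> f)"
    by (rule linear_ext_bas[OF comp1[OF lin_lmul_z] comp2]) (auto simp: lmul_z_mon mon mult.assoc)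
  then have uz: "\<phi> (lmul_z f) = u * \<phi> f" for f by meson
  have vu: "v * u ^ j = s (of_real (q ^ (2 * j))) (u ^ j * v) + s (of_real (1 - q ^ (2 * j))) (u ^ (j - 1))" for j
  proof (induction j)
    case 0 show ?case by simp
  next
    case (Suc j)
    let ?c = "\<lambda>x::real. complex_of_real x"
    have *: "s (?c (q\<^sup>2)) (s (?c (1 - q ^ (2 * j))) (u * u ^ (j - 1))) = s (?c (q\<^sup>2 * (1 - q ^ (2 * j)))) (u ^ j)"
      by (cases j) simp_all
    have "v * u ^ Suc j = s (?c (q\<^sup>2)) (u * (v * u ^ j)) + s (?c (1 - q\<^sup>2)) (u ^ j)"
      using arg_cong[OF rel, of "\<lambda>x. x * u ^ j"] by (simp add: mult.assoc distrib_right s1)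
    also have "\<dots> = s (?c (q\<^sup>2)) (s (?c (q ^ (2 * j))) (u * (u ^ j * v)))
        + s (?c (q\<^sup>2 * (1 - q ^ (2 * j)))) (u ^ j) + s (?c (1 - q\<^sup>2)) (u ^ j)"
      by (simp only: Suc.IH distrib_left s2 scale_right_distrib *)
    also have "\<dots> = s (?c (q ^ (2 * Suc j))) (u ^ Suc j * v)
        + s (?c (q\<^sup>2 * (1 - q ^ (2 * j))) + ?c (1 - q\<^sup>2)) (u ^ j)"
      by (simp add: scale_left_distrib add.assoc mult.assoc power2_eq_square)
    also have "?c (q\<^sup>2 * (1 - q ^ (2 * j))) + ?c (1 - q\<^sup>2) = ?c (1 - q ^ (2 * Suc j))"
      by (simp add: algebra_simps power2_eq_square)
    finally show ?case by simp
  qed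
  have "(\<lambda>f. \<phi> (lmul_zs q f)) = (\<lambda>f. v * \<phi> f)"
  proof (rule linear_ext_bas[OF comp1[OF lin_lmul_zs] comp2])
    fix k :: "nat \<times> nat"
    obtain a b where k: "k = (a, b)" by (cases k)
    have "v * (u ^ a * v ^ b) = (v * u ^ a) * v ^ b" by (simp add: mult.assoc)
    then show "\<phi> (lmul_zs q (bas k)) = v * \<phi> (bas k)"
      by (simp add: k lmul_zs_mon mon L.add L.scale vu distrib_right s1 mult.assoc del: scl_single)
  qed
  then have vz: "\<phi> (lmul_zs q f) = v * \<phi> f" for f by meson
  have "(\<lambda>f. \<phi> (pmul q f g)) = (\<lambda>f. \<phi> f * \<phi> g)" for g
  proof (rule linear_ext_bas[OF comp1[OF lin_pmul_left] comp3])
    fix k :: "nat \<times> nat"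
    obtain a b where k: "k = (a, b)" by (cases k)
    have 1: "\<phi> ((lmul_zs q ^^ b) g) = v ^ b * \<phi> g"
      by (induction b) (simp_all add: vz mult.assoc)
    have "\<phi> ((lmul_z ^^ a) f) = u ^ a * \<phi> f" for f
      by (induction a) (simp_all add: uz mult.assoc)
    then show "\<phi> (pmul q (bas k) g) = \<phi> (bas k) * \<phi> g"
      by (simp add: k pmul_mon mon 1 mult.assoc)
  qed
  then have mult: "\<phi> (pmul q f g) = \<phi> f * \<phi> g" for f g by meson
  have gens: "\<phi> pone = 1" "\<phi> gen_z = u" "\<phi> gen_zs = v"
    by (simp_all add: pone_def gen_z_def gen_zs_def mon)
  show ?thesis
  proof (rule ex1I[of _ \<phi>])
    fix \<psi>
    assume a: "Vector_Spaces.linear scl s \<psi> \<and> \<psi> pone = 1 \<and>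
           (\<forall>f g. \<psi> (pmul q f g) = \<psi> f * \<psi> g) \<and> \<psi> gen_z = u \<and> \<psi> gen_zs = v"
    have 1: "\<psi> ((pmul q gen_z ^^ j) f) = u ^ j * \<psi> f" for j f
      by (induction j) (simp_all add: a mult.assoc)
    have 2: "\<psi> ((pmul q gen_zs ^^ j) f) = v ^ j * \<psi> f" for j f
      by (induction j) (simp_all add: a mult.assoc)
    have "\<psi> (bas k) = \<phi> (bas k)" for k
    proof -
      obtain a b where k: "k = (a, b)" by (cases k)
      show ?thesis unfolding k mon by (subst mon_eq[of _ _ q]) (simp add: 1 2 a)
    qed
    then show "\<psi> = \<phi>" using a L by (blast intro: linear_ext_bas)
  qed (use L mult gens in auto)
qed


section \<open>The first order calculus \<open>\<Omega>\<^sup>1(\<complex>)\<^sub>q\<close>\<close>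

text \<open>
  The pair \<open>(f, g)\<close> stands for \<open>dz f + dz\<^sup>* g\<close>. The commutation relations let every
  coefficient pass from the left of \<open>dz\<close> or \<open>dz\<^sup>*\<close> to the right at the cost of
  \<open>z \<mapsto> q\<^sup>-\<^sup>2 z\<close>, \<open>z\<^sup>* \<mapsto> q\<^sup>2 z\<^sup>*\<close> (the map \<open>twist\<close>). The lemmas below show that this is
  (for \<open>q \<noteq> 0\<close>) the bimodule presented by the generators \<open>dz\<close>, \<open>dz\<^sup>*\<close> and the four relations, and that
  \<open>dif q\<close> is the unique derivation with \<open>z \<mapsto> dz\<close>, \<open>z\<^sup>* \<mapsto> dz\<^sup>*\<close>.
\<close>
type_synonym omega = "pol \<times> pol"

definition oscl :: "complex \<Rightarrow> omega \<Rightarrow> omega" where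
  "oscl c w = (scl c (fst w), scl c (snd w))"

definition dz :: omega where "dz = (pone, 0)"
definition dzs :: omega where "dzs = (0, pone)"

definition twist :: "real \<Rightarrow> pol \<Rightarrow> pol" where
  "twist q = lin_ext scl (\<lambda>(j, k). scl (of_real (q ^ (2 * k) / q ^ (2 * j))) (mon j k))"

definition ract :: "real \<Rightarrow> omega \<Rightarrow> pol \<Rightarrow> omega" where
  "ract q w f = (pmul q (fst w) f, pmul q (snd w) f)"

definition lact :: "real \<Rightarrow> pol \<Rightarrow> omega \<Rightarrow> omega" where
  "lact q f w = (pmul q (twist q f) (fst w), pmul q (twist q f) (snd w))"

text \<open>The Leibniz rule applied to \<open>z\<^sup>j z\<^sup>*\<^sup>k\<close>, extended linearly.\<close>
definition dif :: "real \<Rightarrow> pol \<Rightarrow> omega" where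
  "dif q = lin_ext oscl (\<lambda>(j, k).
     (\<Sum>i<j. ract q (lact q (mon i 0) dz) (mon (j - 1 - i) k)) +
     (\<Sum>i<k. ract q (lact q (mon j i) dzs) (mon 0 (k - 1 - i))))"

lemma vector_space_oscl: "vector_space oscl"
  by unfold_locales (auto simp: oscl_def scl_rules)

lemma lin_twist: "lin (twist q)"
  unfolding twist_def by (rule lin_lin_ext)

lemma twist_mon: "twist q (mon j k) = scl (of_real (q ^ (2 * k) / q ^ (2 * j))) (mon j k)"
  by (simp add: twist_def del: scl_single)

lemma twist_pone [simp]: "twist q pone = pone"
  by (simp add: pone_def twist_mon)

lemma twist_lmul_z: "q \<noteq> 0 \<Longrightarrow> twist q (lmul_z f) = scl (of_real (1 / q\<^sup>2)) (lmul_z (twist q f))"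
  by (rule lin_eqI[where f = "\<lambda>f. twist q (lmul_z f)"])
     (auto simp: lmul_z_mon twist_mon lin_scl[OF lin_lmul_z] scl_rules power2_eq_square mult.assoc
        intro!: lin_comp[OF lin_twist] lin_lmul_z lin_scale lin_comp[OF lin_lmul_z] lin_twist simp del: scl_single)

lemma twist_lmul_zs: "q \<noteq> 0 \<Longrightarrow> twist q (lmul_zs q f) = scl (of_real (q\<^sup>2)) (lmul_zs q (twist q f))"
proof (rule lin_eqI[where f = "\<lambda>f. twist q (lmul_zs q f)"])
  fix k :: "nat \<times> nat"
  assume "q \<noteq> 0"
  obtain a b where k: "k = (a, b)" by (cases k)
  show "twist q (lmul_zs q (bas k)) = scl (of_real (q\<^sup>2)) (lmul_zs q (twist q (bas k)))"
    using \<open>q \<noteq> 0\<close> unfolding k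
    by (cases a) (auto simp: lmul_zs_mon twist_mon lin_scl[OF lin_lmul_zs] lin_add[OF lin_twist]
          lin_scl[OF lin_twist] scl_rules power2_eq_square lookup_add lookup_single when_def field_simps
          simp del: scl_single intro!: poly_mapping_eqI)
qed (auto intro!: lin_comp[OF lin_twist] lin_lmul_zs lin_scale lin_comp[OF lin_lmul_zs] lin_twist)

lemma twist_pmul:
  assumes "q \<noteq> 0"
  shows "twist q (pmul q f g) = pmul q (twist q f) (twist q g)"
proof (rule lin_eqI[where f = "\<lambda>f. twist q (pmul q f g)"])
  fix k :: "nat \<times> nat"
  obtain a b where k: "k = (a, b)" by (cases k)
  have 1: "twist q ((lmul_zs q ^^ b) g) = scl (of_real (q ^ (2 * b))) ((lmul_zs q ^^ b) (twist q g))"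
    by (induction b) (simp_all add: twist_lmul_zs assms scl_rules lin_scl[OF lin_lmul_zs]
        power2_eq_square mult_ac)
  have 2: "twist q ((lmul_z ^^ a) g) = scl (of_real (1 / q ^ (2 * a))) ((lmul_z ^^ a) (twist q g))" for g
    by (induction a) (simp_all add: twist_lmul_z assms scl_rules lin_scl[OF lin_lmul_z]
        power2_eq_square mult_ac)
  show "twist q (pmul q (bas k) g) = pmul q (twist q (bas k)) (twist q g)"
    by (simp add: k twist_mon pmul_lin pmul_mon 1 2 lin_scl[OF lin_funpow[OF lin_lmul_z]] scl_rules
        del: scl_single)
qed (auto intro!: lin_comp[OF lin_twist] lin_comp[OF lin_pmul_left] lin_pmul_left lin_twist)

lemma twist_inverse:
  assumes "q \<noteq> 0"
  shows "twist (1 / q) (twist q f) = f" "twist q (twist (1 / q) f) = f"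
  by (rule lin_eqI[where f = "\<lambda>f. twist (1 / q) (twist q f)"]
           lin_eqI[where f = "\<lambda>f. twist q (twist (1 / q) f)"];
      use assms in \<open>auto simp: twist_mon lin_scl[OF lin_twist] scl_rules field_simps
        intro!: lin_comp[OF lin_twist] lin_twist lin_id simp del: scl_single\<close>)+

locale pol_bimodule =
  fixes q :: real and s :: "complex \<Rightarrow> 'm \<Rightarrow> 'm::ab_group_add"
    and L :: "pol \<Rightarrow> 'm \<Rightarrow> 'm" and R :: "'m \<Rightarrow> pol \<Rightarrow> 'm"
  assumes vector_space: "vector_space s"
    and L_linear: "L f (v + w) = L f v + L f w" "L f (s c v) = s c (L f v)"
      "L (f + g) v = L f v + L g v" "L (scl c f) v = s c (L f v)"
    and R_linear: "R (v + w) f = R v f + R w f" "R (s c v) f = s c (R v f)"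
      "R v (f + g) = R v f + R v g" "R v (scl c f) = s c (R v f)"
    and L_mult: "L (pmul q f g) v = L f (L g v)" and L_one: "L pone v = v"
    and R_mult: "R v (pmul q f g) = R (R v f) g" and R_one: "R v pone = v"
    and L_R: "L f (R v g) = R (L f v) g"

theorem omega_bimodule:
  assumes "q \<noteq> 0"
  shows "pol_bimodule q oscl (lact q) (ract q)"
  by (rule pol_bimodule.intro)
     (simp_all add: vector_space_oscl lact_def ract_def oscl_def pmul_lin pmul_assoc twist_pmul
       lin_add[OF lin_twist] lin_scl[OF lin_twist] assms)

theorem omega_relations:
  assumes "q \<noteq> 0"
  shows "lact q gen_z dz = oscl (of_real (1 / q\<^sup>2)) (ract q dz gen_z)"
    and "lact q gen_zs dzs = oscl (of_real (q\<^sup>2)) (ract q dzs gen_zs)"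
    and "lact q gen_zs dz = oscl (of_real (q\<^sup>2)) (ract q dz gen_zs)"
    and "lact q gen_z dzs = oscl (of_real (1 / q\<^sup>2)) (ract q dzs gen_z)"
proof -
  have "pmul q f 0 = 0" "pmul q 0 f = 0" for f
    using pmul_lin(2)[of q 0 0 f] pmul_lin(4)[of q f 0 0] by (simp_all add: scl_rules)
  moreover have "twist q gen_z = scl (of_real (1 / q\<^sup>2)) gen_z" "twist q gen_zs = scl (of_real (q\<^sup>2)) gen_zs"
    by (simp_all add: gen_z_def gen_zs_def twist_mon del: scl_single)
  ultimately show "lact q gen_z dz = oscl (of_real (1 / q\<^sup>2)) (ract q dz gen_z)"
    and "lact q gen_zs dzs = oscl (of_real (q\<^sup>2)) (ract q dzs gen_zs)"
    and "lact q gen_zs dz = oscl (of_real (q\<^sup>2)) (ract q dz gen_zs)"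
    and "lact q gen_z dzs = oscl (of_real (1 / q\<^sup>2)) (ract q dzs gen_z)"
    by (simp_all add: lact_def ract_def dz_def dzs_def oscl_def scl_rules)
qed

lemma pmul_0 [simp]: "pmul q f 0 = 0" "pmul q 0 f = 0"
  using pmul_lin(2)[of q 0 0 f] pmul_lin(4)[of q f 0 0] by (simp_all add: scl_rules)

lemma omega_decomp: "ract q dz f + ract q dzs g = (f, g)"
  by (simp add: ract_def dz_def dzs_def)

lemma (in pol_bimodule) twist_commute:
  assumes "q \<noteq> 0" and z: "L gen_z u = s (of_real (1 / q\<^sup>2)) (R u gen_z)"
    and zs: "L gen_zs u = s (of_real (q\<^sup>2)) (R u gen_zs)"
  shows "L f u = R u (twist q f)"
proof -
  have "(\<lambda>f. L f u) = (\<lambda>f. R u (twist q f))"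
  proof (rule linear_ext_bas)
    show "Vector_Spaces.linear scl s (\<lambda>f. L f u)" "Vector_Spaces.linear scl s (\<lambda>f. R u (twist q f))"
      by (rule lin_alg_I[OF vector_space]; simp add: L_linear R_linear lin_add[OF lin_twist] lin_scl[OF lin_twist])+
    fix k :: "nat \<times> nat"
    obtain a b where k: "k = (a, b)" by (cases k)
    have 1: "L (lmul_zs q f) u = R u (twist q (lmul_zs q f))" if "L f u = R u (twist q f)" for f
      using that zs by (simp add: pmul_gen_zs[symmetric] L_mult L_R R_linear)
        (simp add: R_mult[symmetric] pmul_gen_zs twist_lmul_zs assms R_linear)
    have 2: "L (lmul_z f) u = R u (twist q (lmul_z f))" if "L f u = R u (twist q f)" for f
      using that z by (simp add: pmul_gen_z[of q, symmetric] L_mult L_R R_linear)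
        (simp add: R_mult[symmetric] pmul_gen_z twist_lmul_z assms R_linear)
    have "L (mon 0 b) u = R u (twist q (mon 0 b))"
    proof (induction b)
      case 0 show ?case by (simp add: pone_def[symmetric] L_one R_one)
    next
      case (Suc b)
      then show ?case using 1[OF Suc] lmul_zs_pow[of 1 q b] by simp
    qed
    then have "L (mon a b) u = R u (twist q (mon a b))"
    proof (induction a)
      case (Suc a)
      then show ?case using 2[of "mon a b"] by (simp add: lmul_z_mon)
    qed
    then show "L (bas k) u = R u (twist q (bas k))" by (simp add: k)
  qed
  then show ?thesis by meson
qed

theorem omega_universal:
  assumes "q \<noteq> 0" "pol_bimodule q s L R"
    and u: "L gen_z u = s (of_real (1 / q\<^sup>2)) (R u gen_z)" "L gen_zs u = s (of_real (q\<^sup>2)) (R u gen_zs)"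
    and v: "L gen_z v = s (of_real (1 / q\<^sup>2)) (R v gen_z)" "L gen_zs v = s (of_real (q\<^sup>2)) (R v gen_zs)"
  shows "\<exists>!\<phi>. (\<forall>w w'. \<phi> (w + w') = \<phi> w + \<phi> w') \<and> (\<forall>f w. \<phi> (lact q f w) = L f (\<phi> w)) \<and>
           (\<forall>f w. \<phi> (ract q w f) = R (\<phi> w) f) \<and> \<phi> dz = u \<and> \<phi> dzs = v"
proof -
  interpret M: pol_bimodule q s L R by fact
  interpret V: vector_space s by (rule M.vector_space)
  have R0: "R w 0 = 0" for w using M.R_linear(4)[of w 0 0] by (simp add: scl_rules)
  show ?thesis
  proof (rule ex1I[of _ "\<lambda>w. R u (fst w) + R v (snd w)"], intro conjI allI)
    fix \<psi>
    assume a: "(\<forall>w w'. \<psi> (w + w') = \<psi> w + \<psi> w') \<and> (\<forall>f w. \<psi> (lact q f w) = L f (\<psi> w)) \<and>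
           (\<forall>f w. \<psi> (ract q w f) = R (\<psi> w) f) \<and> \<psi> dz = u \<and> \<psi> dzs = v"
    show "\<psi> = (\<lambda>w. R u (fst w) + R v (snd w))"
    proof
      fix w
      have "\<psi> (ract q dz (fst w) + ract q dzs (snd w)) = R u (fst w) + R v (snd w)"
        by (simp add: a)
      then show "\<psi> w = R u (fst w) + R v (snd w)" by (simp add: omega_decomp)
    qed
  next
    fix f w
    show "R u (fst (lact q f w)) + R v (snd (lact q f w)) = L f (R u (fst w) + R v (snd w))"
      by (simp add: lact_def M.L_linear M.L_R M.R_mult M.twist_commute[OF assms(1) u] M.twist_commute[OF assms(1) v])
  qed (simp_all add: M.R_linear ract_def M.R_mult dz_def dzs_def M.R_one R0)
qed

lemma dif_linear: "Vector_Spaces.linear scl oscl (dif q)"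
  unfolding dif_def by (rule lin_ext_linear[OF vector_space_oscl])

lemma dif_add: "dif q (f + g) = dif q f + dif q g" and dif_scl: "dif q (scl c f) = oscl c (dif q f)"
  using dif_linear[of q] by (simp_all add: Vector_Spaces.linear_iff)

lemma dif_mon: "dif q (mon j k) =
     (\<Sum>i<j. ract q (lact q (mon i 0) dz) (mon (j - 1 - i) k)) +
     (\<Sum>i<k. ract q (lact q (mon j i) dzs) (mon 0 (k - 1 - i)))"
  by (simp add: dif_def vector_space_oscl)

lemma dif_gen: "dif q gen_z = dz" "dif q gen_zs = dzs" "dif q pone = 0"
  by (simp_all add: gen_z_def gen_zs_def pone_def dif_mon)
     (simp_all add: pone_def[symmetric] lact_def ract_def dz_def dzs_def)

context
  fixes q :: real assumes q0: "q \<noteq> 0"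
begin

interpretation W: pol_bimodule q oscl "lact q" "ract q"
  by (rule omega_bimodule[OF q0])

interpretation WV: vector_space oscl
  by (rule vector_space_oscl)

lemma lact_sum: "lact q f (sum w A) = (\<Sum>i\<in>A. lact q f (w i))"
  using W.L_linear(2)[of f 0 0]
  by (induction A rule: infinite_finite_induct) (simp_all add: W.L_linear)

lemma dif_lmul_z: "dif q (lmul_z g) = ract q dz g + lact q gen_z (dif q g)"
proof -
  have "dif q \<circ> lmul_z = (\<lambda>g. ract q dz g + lact q gen_z (dif q g))"
  proof (rule linear_ext_bas)
    show "Vector_Spaces.linear scl oscl (dif q \<circ> lmul_z)"
      by (rule lin_alg_I[OF vector_space_oscl]) (simp_all add: lin_add[OF lin_lmul_z] lin_scl[OF lin_lmul_z] dif_add dif_scl)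
    show "Vector_Spaces.linear scl oscl (\<lambda>g. ract q dz g + lact q gen_z (dif q g))"
      by (rule lin_alg_I[OF vector_space_oscl]) (simp_all add: W.R_linear W.L_linear dif_add dif_scl WV.scale_right_distrib)
    fix k :: "nat \<times> nat"
    obtain a b where k: "k = (a, b)" by (cases k)
    have *: "lact q gen_z (ract q (lact q (mon i j) w) h) = ract q (lact q (mon (Suc i) j) w) h" for i j w h
      by (simp add: W.L_R W.L_mult[symmetric] pmul_gen_z lmul_z_mon)
    show "(dif q \<circ> lmul_z) (bas k) = ract q dz (bas k) + lact q gen_z (dif q (bas k))"
      unfolding k by (simp add: lmul_z_mon dif_mon W.L_linear lact_sum * sum.lessThan_Suc_shift del: sum.lessThan_Suc)
        (simp add: pone_def[symmetric] W.L_one)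
  qed
  then show ?thesis by (metis comp_apply)
qed

lemma dif_lmul_zs: "dif q (lmul_zs q g) = ract q dzs g + lact q gen_zs (dif q g)"
proof -
  have "dif q \<circ> lmul_zs q = (\<lambda>g. ract q dzs g + lact q gen_zs (dif q g))"
  proof (rule linear_ext_bas)
    show "Vector_Spaces.linear scl oscl (dif q \<circ> lmul_zs q)"
      by (rule lin_alg_I[OF vector_space_oscl]) (simp_all add: lin_add[OF lin_lmul_zs] lin_scl[OF lin_lmul_zs] dif_add dif_scl)
    show "Vector_Spaces.linear scl oscl (\<lambda>g. ract q dzs g + lact q gen_zs (dif q g))"
      by (rule lin_alg_I[OF vector_space_oscl]) (simp_all add: W.R_linear W.L_linear dif_add dif_scl WV.scale_right_distrib)
    fix k :: "nat \<times> nat"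
    obtain a b where k: "k = (a, b)" by (cases k)
    have *: "lact q gen_zs (ract q (lact q (mon 0 j) w) h) = ract q (lact q (mon 0 (Suc j)) w) h" for j w h
      using lmul_zs_pow[of 1 q j] by (simp add: W.L_R W.L_mult[symmetric] pmul_gen_zs)
    have "dif q (lmul_zs q (mon a b)) = ract q dzs (mon a b) + lact q gen_zs (dif q (mon a b))"
    proof (induction a)
      case 0
      have "lmul_zs q (mon 0 b) = mon 0 (Suc b)" using lmul_zs_pow[of 1 q b] by simp
      then show ?case
        by (simp add: dif_mon W.L_linear lact_sum * sum.lessThan_Suc_shift del: sum.lessThan_Suc)
           (simp add: pone_def[symmetric] W.L_one)
    next
      case (Suc a)
      let ?m = "mon a b"
      let ?c = "complex_of_real (q\<^sup>2)"
      have c: "?c * of_real (1 / q\<^sup>2) = 1" using q0 by simp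
      have "dif q (lmul_zs q (mon (Suc a) b)) = dif q (lmul_zs q (lmul_z ?m))"
        by (simp add: lmul_z_mon)
      also have "\<dots> = oscl ?c (dif q (lmul_z (lmul_zs q ?m))) + oscl (of_real (1 - q\<^sup>2)) (dif q ?m)"
        by (simp only: lmul_rel dif_add dif_scl)
      also have "\<dots> = oscl ?c (ract q dz (pmul q gen_zs ?m)) + oscl ?c (ract q (lact q gen_z dzs) ?m)
          + (oscl ?c (lact q gen_z (lact q gen_zs (dif q ?m))) + oscl (of_real (1 - q\<^sup>2)) (dif q ?m))"
        by (simp only: dif_lmul_z Suc.IH W.L_linear WV.scale_right_distrib W.L_R pmul_gen_zs add_ac)
      also have "oscl ?c (lact q gen_z (lact q gen_zs (dif q ?m))) + oscl (of_real (1 - q\<^sup>2)) (dif q ?m)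
          = lact q (pmul q gen_zs gen_z) (dif q ?m)"
        by (simp only: pmul_relation W.L_linear W.L_mult W.L_one)
      also have "oscl ?c (ract q (lact q gen_z dzs) ?m) = ract q (ract q dzs gen_z) ?m"
        using c by (simp add: omega_relations[OF q0] W.R_linear WV.scale_scale del: of_real_power)
      also have "oscl ?c (ract q dz (pmul q gen_zs ?m)) = ract q (lact q gen_zs dz) ?m"
        by (simp add: omega_relations[OF q0] W.R_linear W.R_mult)
      finally show ?case
        by (simp add: lmul_z_mon[symmetric] dif_lmul_z W.L_linear W.L_R W.L_mult)
           (simp add: pmul_gen_z[of q, symmetric] W.R_mult)
    qed
    then show "(dif q \<circ> lmul_zs q) (bas k) = ract q dzs (bas k) + lact q gen_zs (dif q (bas k))"
      by (simp add: k)
  qed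
  then show ?thesis by (metis comp_apply)
qed

theorem dif_leibniz: "dif q (pmul q f g) = ract q (dif q f) g + lact q f (dif q g)"
proof -
  have "(\<lambda>f. dif q (pmul q f g)) = (\<lambda>f. ract q (dif q f) g + lact q f (dif q g))"
  proof (rule linear_ext_bas)
    show "Vector_Spaces.linear scl oscl (\<lambda>f. dif q (pmul q f g))"
      by (rule lin_alg_I[OF vector_space_oscl]) (simp_all add: pmul_lin dif_add dif_scl)
    show "Vector_Spaces.linear scl oscl (\<lambda>f. ract q (dif q f) g + lact q f (dif q g))"
      by (rule lin_alg_I[OF vector_space_oscl]) (simp_all add: W.R_linear W.L_linear dif_add dif_scl WV.scale_right_distrib)
    fix k :: "nat \<times> nat"
    obtain a b where k: "k = (a, b)" by (cases k)
    define P where "P f \<longleftrightarrow> dif q (pmul q f g) = ract q (dif q f) g + lact q f (dif q g)" for f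
    have 1: "P (lmul_zs q f)" if "P f" for f
      using that unfolding P_def
      by (simp add: pmul_lmul_zs dif_lmul_zs W.L_linear W.R_linear W.L_R W.R_mult)
         (simp add: pmul_gen_zs[symmetric] W.L_mult)
    have 2: "P (lmul_z f)" if "P f" for f
      using that unfolding P_def
      by (simp add: pmul_lmul_z dif_lmul_z W.L_linear W.R_linear W.L_R W.R_mult)
         (simp add: pmul_gen_z[of q, symmetric] W.L_mult)
    have "P (mon 0 b)"
    proof (induction b)
      case 0
      have "ract q 0 g = 0" by (simp add: ract_def zero_prod_def)
      then show ?case by (simp add: P_def pone_def[symmetric] dif_gen W.L_one)
    next
      case (Suc b)
      then show ?case using 1[OF Suc] lmul_zs_pow[of 1 q b] by simp
    qed
    then have "P (mon a b)"
    proof (induction a)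
      case (Suc a)
      then show ?case using 2[of "mon a b"] by (simp add: lmul_z_mon)
    qed
    then show "dif q (pmul q (bas k) g) = ract q (dif q (bas k)) g + lact q (bas k) (dif q g)"
      by (simp add: k P_def)
  qed
  then show ?thesis by meson
qed

theorem dif_unique:
  assumes D: "Vector_Spaces.linear scl oscl D"
    and leib: "\<And>f g. D (pmul q f g) = ract q (D f) g + lact q f (D g)"
    and gens: "D gen_z = dz" "D gen_zs = dzs"
  shows "D = dif q"
proof (rule linear_ext_bas[OF D dif_linear])
  fix k :: "nat \<times> nat"
  obtain a b where k: "k = (a, b)" by (cases k)
  have D1: "D pone = 0" using leib[of pone pone] by (simp add: W.L_one W.R_one)
  have b: "D (mon 0 b) = dif q (mon 0 b)"
  proof (induction b)
    case 0 show ?case by (simp add: pone_def[symmetric] D1 dif_gen)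
  next
    case (Suc b)
    have "mon 0 (Suc b) = pmul q gen_zs (mon 0 b)" using lmul_zs_pow[of 1 q b] by (simp add: pmul_gen_zs)
    then show ?case by (simp only: leib dif_leibniz Suc gens dif_gen)
  qed
  have "D (mon a b) = dif q (mon a b)"
  proof (induction a)
    case 0 show ?case by (rule b)
  next
    case (Suc a)
    have "mon (Suc a) b = pmul q gen_z (mon a b)" by (simp add: pmul_gen_z lmul_z_mon)
    then show ?case by (simp only: leib dif_leibniz Suc gens dif_gen)
  qed
  then show "D (bas k) = dif q (bas k)" by (simp add: k)
qed

end

text \<open>Each pair is (derivative with respect to \<open>z\<close>, derivative with respect to \<open>z\<^sup>*\<close>).\<close>

definition right_partials :: "real \<Rightarrow> pol \<Rightarrow> pol \<times> pol" where
  "right_partials q f = (THE p. dif q f = lact q (fst p) dz + lact q (snd p) dzs)"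

definition left_partials :: "real \<Rightarrow> pol \<Rightarrow> pol \<times> pol" where
  "left_partials q f = (THE p. dif q f = ract q dz (fst p) + ract q dzs (snd p))"

definition dr_zs :: "real \<Rightarrow> pol \<Rightarrow> pol" where "dr_zs q f = snd (right_partials q f)"
definition dl_z :: "real \<Rightarrow> pol \<Rightarrow> pol" where "dl_z q f = fst (left_partials q f)"

lemma ex1_right_partials:
  assumes "q \<noteq> 0"
  shows "\<exists>!p. w = lact q (fst p) dz + lact q (snd p) dzs"
proof -
  have "lact q a dz + lact q b dzs = (twist q a, twist q b)" for a b
    by (simp add: lact_def dz_def dzs_def)
  then show ?thesis
    by (intro ex1I[of _ "(twist (1 / q) (fst w), twist (1 / q) (snd w))"])
       (auto simp: twist_inverse[OF assms])
qed

lemma ex1_left_partials: "\<exists>!p. w = ract q dz (fst p) + ract q dzs (snd p)"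
  unfolding omega_decomp by (intro ex1I[of _ w]) auto

lemma dif_right_partials:
  "q \<noteq> 0 \<Longrightarrow> dif q f = lact q (fst (right_partials q f)) dz + lact q (dr_zs q f) dzs"
  unfolding dr_zs_def right_partials_def by (rule theI'[OF ex1_right_partials])

lemma dif_left_partials:
  "dif q f = ract q dz (dl_z q f) + ract q dzs (snd (left_partials q f))"
  unfolding dl_z_def left_partials_def by (rule theI'[OF ex1_left_partials])

lemma dl_z_eq: "dl_z q f = fst (dif q f)"
  using dif_left_partials[of q f] by (simp add: omega_decomp)

lemma dr_zs_eq: "q \<noteq> 0 \<Longrightarrow> dr_zs q f = twist (1 / q) (snd (dif q f))"
  using dif_right_partials[of q f] by (simp add: lact_def dz_def dzs_def twist_inverse)

lemma lin_dl_z: "lin (dl_z q)"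
  by (rule linI) (simp_all add: dl_z_eq dif_add dif_scl oscl_def)

lemma lin_dr_zs: "q \<noteq> 0 \<Longrightarrow> lin (dr_zs q)"
  by (rule linI)
     (simp_all add: dr_zs_eq dif_add dif_scl oscl_def lin_add[OF lin_twist] lin_scl[OF lin_twist])


section \<open>The tensor square\<close>

text \<open>Coefficients in the basis \<open>z\<^sup>j z\<^sup>*\<^sup>k \<otimes> z\<^sup>l z\<^sup>*\<^sup>m\<close>.\<close>
type_synonym pol2 = "(nat \<times> nat) \<times> (nat \<times> nat) \<Rightarrow>\<^sub>0 complex"

definition tens :: "pol \<Rightarrow> pol \<Rightarrow> pol2" where
  "tens f g = lin_ext scl (\<lambda>a. lin_ext scl (\<lambda>b. bas (a, b)) g) f"

definition tmul :: "real \<Rightarrow> pol2 \<Rightarrow> pol2 \<Rightarrow> pol2" where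
  "tmul q S T = lin_ext scl (\<lambda>(a, b). lin_ext scl (\<lambda>(c, d).
     tens (pmul q (bas a) (bas c)) (pmul q (bas b) (bas d))) T) S"

lemma lin_tens_left: "lin (\<lambda>f. tens f g)"
  unfolding tens_def by (rule lin_lin_ext)

lemma lin_tens_right: "lin (tens f)"
proof -
  have "lin (\<lambda>g. tens f g)"
    unfolding tens_def by (rule lin_ext_arg_lin) (rule lin_lin_ext)
  then show ?thesis .
qed

lemma tens_bas [simp]: "tens (bas a) (bas b) = bas (a, b)"
  by (simp add: tens_def)

lemma bilinear_eqI:
  assumes "\<And>g. Vector_Spaces.linear scl s (\<lambda>f. B f g)" "\<And>f. Vector_Spaces.linear scl s (B f)"
    and "\<And>g. Vector_Spaces.linear scl s (\<lambda>f. B' f g)" "\<And>f. Vector_Spaces.linear scl s (B' f)"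
    and "\<And>a b. B (bas a) (bas b) = B' (bas a) (bas b)"
  shows "B f g = B' f g"
proof -
  have "B (bas a) = B' (bas a)" for a
    by (rule linear_ext_bas[OF assms(2) assms(4)]) (rule assms(5))
  then have "(\<lambda>f. B f g) = (\<lambda>f. B' f g)"
    by (intro linear_ext_bas[OF assms(1) assms(3)]) simp
  then show ?thesis by meson
qed

theorem tens_universal:
  fixes s :: "complex \<Rightarrow> 'b \<Rightarrow> 'b::ab_group_add"
  assumes s: "vector_space s"
    and B: "\<And>g. Vector_Spaces.linear scl s (\<lambda>f. B f g)" "\<And>f. Vector_Spaces.linear scl s (B f)"
  shows "\<exists>!\<phi>. Vector_Spaces.linear scl s \<phi> \<and> (\<forall>f g. \<phi> (tens f g) = B f g)"
proof -
  define \<phi> where "\<phi> = lin_ext s (\<lambda>(a, b). B (bas a) (bas b))"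
  have L: "Vector_Spaces.linear scl s \<phi>" unfolding \<phi>_def by (rule lin_ext_linear[OF s])
  have add: "\<phi> (x + y) = \<phi> x + \<phi> y" and sc: "\<phi> (scl c x) = s c (\<phi> x)" for x y c
    using L by (simp_all add: Vector_Spaces.linear_iff)
  have t: "\<phi> (tens f g) = B f g" for f g
  proof (rule bilinear_eqI[where s = s and B = "\<lambda>f g. \<phi> (tens f g)" and B' = B])
    show "Vector_Spaces.linear scl s (\<lambda>f. \<phi> (tens f g))" for g
      by (rule lin_alg_I[OF s]) (simp_all add: lin_add[OF lin_tens_left] lin_scl[OF lin_tens_left] add sc)
    show "Vector_Spaces.linear scl s (\<lambda>g. \<phi> (tens f g))" for f
      by (rule lin_alg_I[OF s]) (simp_all add: lin_add[OF lin_tens_right] lin_scl[OF lin_tens_right] add sc)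
  qed (simp_all add: B \<phi>_def s)
  show ?thesis
  proof (rule ex1I[of _ \<phi>])
    fix \<psi> assume a: "Vector_Spaces.linear scl s \<psi> \<and> (\<forall>f g. \<psi> (tens f g) = B f g)"
    have "\<psi> (bas k) = \<phi> (bas k)" for k
      using a t by (metis surj_pair tens_bas)
    then show "\<psi> = \<phi>" using a L by (blast intro: linear_ext_bas)
  qed (use L t in auto)
qed

lemma lin_tmul_left: "lin (\<lambda>S. tmul q S T)"
  unfolding tmul_def by (rule lin_lin_ext)

lemma lin_tmul_right: "lin (tmul q S)"
proof -
  have "lin (\<lambda>T. tmul q S T)"
    unfolding tmul_def by (rule lin_ext_arg_lin) (auto simp: case_prod_beta intro: lin_lin_ext)
  then show ?thesis .
qed

theorem tmul_tens: "tmul q (tens f1 f2) (tens g1 g2) = tens (pmul q f1 g1) (pmul q f2 g2)"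
proof (rule bilinear_eqI[where s = scl and B = "\<lambda>f1 f2. tmul q (tens f1 f2) (tens g1 g2)"])
  fix a b
  show "tmul q (tens (bas a) (bas b)) (tens g1 g2) = tens (pmul q (bas a) g1) (pmul q (bas b) g2)"
    by (rule bilinear_eqI[where s = scl and B = "\<lambda>g1 g2. tmul q (tens (bas a) (bas b)) (tens g1 g2)"])
       (auto simp del: tens_bas intro!: lin_comp[OF lin_tmul_right] lin_tens_left lin_tens_right
         lin_comp[OF lin_tens_left] lin_comp[OF lin_tens_right] lin_pmul_right,
        simp add: tmul_def)
qed (auto intro!: lin_comp[OF lin_tmul_left] lin_tens_left lin_tens_right
         lin_comp[OF lin_tens_left] lin_comp[OF lin_tens_right] lin_pmul_left)


section \<open>The star product\<close>

definition m0 :: "real \<Rightarrow> pol2 \<Rightarrow> pol" where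
  "m0 q = lin_ext scl (\<lambda>(a, b). pmul q (bas a) (bas b))"

lemma lin_m0: "lin (m0 q)"
  unfolding m0_def by (rule lin_lin_ext)

lemma m0_tens: "m0 q (tens f g) = pmul q f g"
  by (rule bilinear_eqI[where s = scl and B = "\<lambda>f g. m0 q (tens f g)"])
     (auto intro!: lin_comp[OF lin_m0] lin_tens_left lin_tens_right lin_pmul_left lin_pmul_right
       simp del: tens_bas, simp add: m0_def)

text \<open>\<open>q\<^sup>-\<^sup>2 (1 - (1 + q\<^sup>-\<^sup>2) z\<^sup>* \<otimes> z + q\<^sup>-\<^sup>2 z\<^sup>*\<^sup>2 \<otimes> z\<^sup>2)\<close>\<close>
definition box_kernel :: "real \<Rightarrow> pol2" where
  "box_kernel q = scl (of_real (1 / q\<^sup>2))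
     (tens pone pone - scl (of_real (1 + 1 / q\<^sup>2)) (tens gen_zs gen_z)
      + scl (of_real (1 / q\<^sup>2)) (tens (pmul q gen_zs gen_zs) (pmul q gen_z gen_z)))"

definition box_pure :: "real \<Rightarrow> pol \<Rightarrow> pol \<Rightarrow> pol2" where
  "box_pure q f1 f2 = tmul q (tmul q (tens (dr_zs q f1) pone) (box_kernel q)) (tens pone (dl_z q f2))"

definition qbox :: "real \<Rightarrow> pol2 \<Rightarrow> pol2" where
  "qbox q = lin_ext scl (\<lambda>(a, b). box_pure q (bas a) (bas b))"

lemma lin_qbox: "lin (qbox q)"
  unfolding qbox_def by (rule lin_lin_ext)

theorem qbox_tens: "q \<noteq> 0 \<Longrightarrow> qbox q (tens f1 f2) = box_pure q f1 f2"
  by (rule bilinear_eqI[where s = scl and B = "\<lambda>f g. qbox q (tens f g)"])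
     (auto intro!: lin_comp[OF lin_qbox] lin_tens_left lin_tens_right lin_comp[OF lin_tmul_left]
        lin_comp[OF lin_tmul_right] lin_comp[OF lin_tens_left] lin_comp[OF lin_tens_right]
        lin_dr_zs lin_dl_z simp: box_pure_def simp del: tens_bas, simp add: qbox_def box_pure_def)

text \<open>\<open>qpoch a b k\<close> is \<open>(a; b)\<^sub>k\<close>.\<close>
definition qpoch :: "real \<Rightarrow> real \<Rightarrow> nat \<Rightarrow> real" where
  "qpoch a b k = (\<Prod>i<k. 1 - b ^ i * a)"

definition p_poly :: "real \<Rightarrow> nat \<Rightarrow> real poly" where
  "p_poly q k = (\<Sum>j\<le>k. smult (qpoch (1 / q ^ (2 * k)) (q\<^sup>2) j / (qpoch (q\<^sup>2) (q\<^sup>2) j)\<^sup>2 * q ^ (2 * j))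
     (\<Prod>i<j. 1 - smult (q ^ (2 * i)) [:1 + q\<^sup>2, (1 - q\<^sup>2)\<^sup>2:] + [:q ^ (4 * i + 2):]))"

definition poly_op :: "real poly \<Rightarrow> (('a \<Rightarrow>\<^sub>0 complex) \<Rightarrow> ('a \<Rightarrow>\<^sub>0 complex)) \<Rightarrow> ('a \<Rightarrow>\<^sub>0 complex) \<Rightarrow> ('a \<Rightarrow>\<^sub>0 complex)" where
  "poly_op p T v = (\<Sum>i\<le>Polynomial.degree p. scl (of_real (coeff p i)) ((T ^^ i) v))"

text \<open>Only used for \<open>k \<ge> 1\<close>.\<close>
definition star_coeff :: "real \<Rightarrow> nat \<Rightarrow> pol \<Rightarrow> pol \<Rightarrow> pol" where
  "star_coeff q k f1 f2 = m0 q (poly_op (p_poly q k - p_poly q (k - 1)) (qbox q) (tens f1 f2))"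

definition star :: "real \<Rightarrow> pol \<Rightarrow> pol \<Rightarrow> pol fps" where
  "star q f1 f2 = Abs_fps (\<lambda>k. if k = 0 then pmul q f1 f2 else star_coeff q k f1 f2)"

text \<open>Multiplication by \<open>t\<^sup>i\<close>, written out because \<open>*\<close> on \<^typ>\<open>pol\<close> is not the product at hand.\<close>
definition t_shift :: "nat \<Rightarrow> pol fps \<Rightarrow> pol fps" where
  "t_shift i F = Abs_fps (\<lambda>n. if n < i then 0 else F $ (n - i))"

text \<open>The topology of \<open>fps\<close> is the \<open>t\<close>-adic one.\<close>
definition star_mult :: "real \<Rightarrow> pol fps \<Rightarrow> pol fps \<Rightarrow> pol fps" where
  "star_mult q F G = suminf (\<lambda>i. t_shift i (\<Sum>j\<le>i. star q (F $ j) (G $ (i - j))))"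

lemma t_shift_sums: "(\<lambda>i. t_shift i (H i)) sums Abs_fps (\<lambda>n. \<Sum>i\<le>n. H i $ (n - i))"
  unfolding sums_def
proof (rule tendsto_fpsI)
  fix n
  have nth: "sum f A $ n = (\<Sum>i\<in>A. f i $ n)" for f :: "nat \<Rightarrow> pol fps" and A
    by (induction A rule: infinite_finite_induct) simp_all
  show "\<forall>\<^sub>F m in sequentially. (\<Sum>i<m. t_shift i (H i)) $ n = Abs_fps (\<lambda>n. \<Sum>i\<le>n. H i $ (n - i)) $ n"
  proof (rule eventually_sequentiallyI[of "Suc n"])
    fix m assume m: "Suc n \<le> m"
    have "(\<Sum>i<m. t_shift i (H i)) $ n = (\<Sum>i<m. if n < i then 0 else H i $ (n - i))"
      by (simp add: nth t_shift_def)
    also have "\<dots> = (\<Sum>i\<le>n. H i $ (n - i))"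
      by (rule sum.mono_neutral_cong_right) (use m in auto)
    finally show "(\<Sum>i<m. t_shift i (H i)) $ n = Abs_fps (\<lambda>n. \<Sum>i\<le>n. H i $ (n - i)) $ n"
      by simp
  qed
qed

theorem star_mult_sums:
  "(\<lambda>i. t_shift i (\<Sum>j\<le>i. star q (F $ j) (G $ (i - j)))) sums star_mult q F G"
  unfolding star_mult_def by (rule summable_sums[OF sums_summable[OF t_shift_sums]])

theorem star_mult_nth:
  "star_mult q F G $ n = (\<Sum>i\<le>n. \<Sum>j\<le>i. star q (F $ j) (G $ (i - j)) $ (n - i))"
proof -
  have nth: "sum f A $ n = (\<Sum>i\<in>A. f i $ n)" for f :: "nat \<Rightarrow> pol fps" and A n
    by (induction A rule: infinite_finite_induct) simp_all
  show ?thesis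
    unfolding star_mult_def sums_unique[OF t_shift_sums, symmetric] by (simp add: nth)
qed

lemma lin_poly_op: "lin T \<Longrightarrow> lin (poly_op p T)"
proof -
  assume T: "lin T"
  interpret V: vector_space scl by (rule vector_space_scl)
  show "lin (poly_op p T)"
    unfolding poly_op_def
    by (rule linI) (simp_all add: lin_add[OF lin_funpow[OF T]] lin_scl[OF lin_funpow[OF T]] scl_rules
       sum.distrib V.scale_sum_right mult.commute)
qed

lemma lin_star_nth: "lin (\<lambda>f. star q f g $ n)" "lin (\<lambda>g. star q f g $ n)"
  unfolding star_def star_coeff_def
  by (cases n; auto intro!: lin_pmul_left lin_pmul_right lin_comp[OF lin_m0] lin_comp[OF lin_poly_op[OF lin_qbox]]
      lin_tens_left lin_tens_right)+

theorem star_mult_bilinear: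
  "star_mult q (F + F') G = star_mult q F G + star_mult q F' G"
  "star_mult q F (G + G') = star_mult q F G + star_mult q F G'"
  "star_mult q (Abs_fps (\<lambda>n. scl c (F $ n))) G = Abs_fps (\<lambda>n. scl c (star_mult q F G $ n))"
  "star_mult q F (Abs_fps (\<lambda>n. scl c (G $ n))) = Abs_fps (\<lambda>n. scl c (star_mult q F G $ n))"
proof -
  interpret V: vector_space scl by (rule vector_space_scl)
  show "star_mult q (F + F') G = star_mult q F G + star_mult q F' G"
    "star_mult q F (G + G') = star_mult q F G + star_mult q F G'"
    "star_mult q (Abs_fps (\<lambda>n. scl c (F $ n))) G = Abs_fps (\<lambda>n. scl c (star_mult q F G $ n))"
    "star_mult q F (Abs_fps (\<lambda>n. scl c (G $ n))) = Abs_fps (\<lambda>n. scl c (star_mult q F G $ n))"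
    by (simp_all add: fps_eq_iff star_mult_nth lin_add[OF lin_star_nth(1)] lin_add[OF lin_star_nth(2)]
        lin_scl[OF lin_star_nth(1)] lin_scl[OF lin_star_nth(2)] sum.distrib V.scale_sum_right)
qed

end

theory Submission
  imports Defs
begin

text \<open>
  Write \<open>Q = q\<^sup>2\<close>. The product \<open>*\<close> is the normal ordered form of the composition of the operators
  \<open>z e\<^sub>m = e\<^sub>m\<^sub>+\<^sub>1\<close>, \<open>z\<^sup>* e\<^sub>m = (1 - Q\<^sup>m) / (1 - t Q\<^sup>m) e\<^sub>m\<^sub>-\<^sub>1\<close>, and associativity is inherited from operators.
  An operator is encoded by its kernel, the matrix whose rows and columns are indexed by the powers of \<open>z\<close> and
  \<open>w\<close>: the normal ordered monomial \<open>z\<^sup>j z\<^sup>*\<^sup>k\<close> has kernel \<open>z\<^sup>j w\<^sup>k \<Sum>\<^sub>r \<kweightpa>\<^sub>r (z w)\<^sup>r\<close> with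
  \<open>\<kweightpa>\<^sub>r = (Q t; Q)\<^sub>r / (Q; Q)\<^sub>r\<close>, and composition multiplies matrices with the weight \<open>1 / \<kweightpa>\<^sub>l\<close> at the
  intermediate index \<open>l\<close>.

  The polynomials \<open>p\<^sub>k\<close> are Al-Salam--Chihara polynomials. Their three-term recurrence says that
  \<open>S(t) = p\<^sub>0 + \<Sum>\<^sub>k (p\<^sub>k - p\<^sub>k\<^sub>-\<^sub>1) t\<^sup>k\<close> satisfies
  \<open>(1 - t) (1 - Q t) (S(t) - S(Q t)) = (1 - Q)\<^sup>2 x t S(t)\<close>. With \<open>x\<close> replaced by the box operator this is
  a \<open>Q\<close>-difference equation for \<open>*\<close> which, together with the value at \<open>t = 0\<close>, determines it; composition of
  operators satisfies the same equation.
\<close>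

section \<open>Recurrence of the polynomials \<open>p\<^sub>k\<close>\<close>

lemma sum_scl: "(\<Sum>i\<in>A. scl (c i) v) = scl (\<Sum>i\<in>A. c i) v"
  by (rule poly_mapping_eqI) (simp add: lookup_sum sum_distrib_right)

lemma qpoch_Suc: "qpoch a b (Suc k) = qpoch a b k * (1 - b ^ k * a)"
  by (simp add: qpoch_def)

lemma qpoch_Suc_shift: "qpoch a b (Suc k) = (1 - a) * qpoch (a * b) b k"
  unfolding qpoch_def by (subst prod.lessThan_Suc_shift) (simp add: mult_ac)

lemma poly_op_bound:
  assumes "Polynomial.degree p \<le> N"
  shows "poly_op p T v = (\<Sum>i\<le>N. scl (of_real (coeff p i)) ((T ^^ i) v))"
  unfolding poly_op_def
  by (rule sum.mono_neutral_left) (use assms in \<open>auto simp: coeff_eq_0 scl_rules\<close>)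

lemma pCons_add_0: "pCons 0 (p + r) = pCons 0 p + pCons 0 (r :: 'a::comm_monoid_add poly)"
  by (simp add: add_pCons)

lemma smult_sum_right: "smult c (\<Sum>i\<in>A. p i) = (\<Sum>i\<in>A. smult c (p i))"
  by (induction A rule: infinite_finite_induct) (simp_all add: smult_add_right)

lemma poly_op_1: "poly_op 1 T v = v"
  by (simp add: poly_op_def scl_rules)

lemma poly_op_add: "poly_op (p + r) T v = poly_op p T v + poly_op r T v"
proof -
  let ?N = "max (Polynomial.degree p) (Polynomial.degree r)"
  have "Polynomial.degree (p + r) \<le> ?N" by (rule degree_add_le_max)
  then show ?thesis
    by (simp add: poly_op_bound[where N = ?N] scl_rules sum.distrib)
qed

lemma poly_op_smult: "poly_op (smult c p) T v = scl (of_real c) (poly_op p T v)"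
proof -
  interpret V: vector_space scl by (rule vector_space_scl)
  show ?thesis
    by (simp add: poly_op_bound[where N = "Polynomial.degree p" and p = "smult c p"] degree_smult_le
        V.scale_sum_right scl_rules, simp add: poly_op_def V.scale_sum_right scl_rules)
qed

lemma poly_op_pCons: "poly_op (pCons 0 p) T v = poly_op p T (T v)"
  unfolding poly_op_bound[OF degree_pCons_le] poly_op_def
  by (simp add: sum.atMost_Suc_shift scl_rules funpow_swap1 del: sum.atMost_Suc)

locale quantum_disc =
  fixes q :: real
  assumes q_pos: "0 < q" and q_less_1: "q < 1"
begin

lemma q2: "0 < q\<^sup>2" "q\<^sup>2 < 1"
  using q_pos q_less_1 by (auto simp: power_less_one_iff)

section \<open>Expansion of \<open>p_poly\<close> in a basis of products, and its three-term
  recurrence\<close>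

definition qbasis :: "nat \<Rightarrow> real poly" where
  "qbasis j = (\<Prod>i<j. 1 - smult (q ^ (2 * i)) [:1 + q\<^sup>2, (1 - q\<^sup>2)\<^sup>2:] + [:q ^ (4 * i + 2):])"

definition qcoef :: "nat \<Rightarrow> nat \<Rightarrow> real" where
  "qcoef n j = qpoch (1 / q ^ (2 * n)) (q\<^sup>2) j / (qpoch (q\<^sup>2) (q\<^sup>2) j)\<^sup>2 * q ^ (2 * j)"

lemma p_poly_eq: "p_poly q n = (\<Sum>j\<le>n. smult (qcoef n j) (qbasis j))"
  by (simp add: p_poly_def qcoef_def qbasis_def)

text \<open>The factor with index n of (Q^(-n); Q)_j vanishes.\<close>

lemma qcoef_eq_0:
  assumes "n < j" shows "qcoef n j = 0"
proof -
  have "1 - (q\<^sup>2) ^ n * (1 / q ^ (2 * n)) = 0"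
    using q_pos by (simp add: power_mult)
  then have "qpoch (1 / q ^ (2 * n)) (q\<^sup>2) j = 0"
    unfolding qpoch_def using assms by (intro prod_zero) auto
  then show ?thesis by (simp add: qcoef_def)
qed

text \<open>Puts neighbouring polynomials over one common range of summation, so that coefficients
  can be compared.\<close>

lemma p_poly_bound:
  assumes "n \<le> N" shows "p_poly q n = (\<Sum>j\<le>N. smult (qcoef n j) (qbasis j))"
  unfolding p_poly_eq by (rule sum.mono_neutral_left) (use assms qcoef_eq_0 in auto)

text \<open>The last factor of \<open>qbasis (Suc j)\<close> is (1 - Q^j)(1 - Q^(j+1)) - Q^j (1 -
  Q)^2 x, so multiplication by x is bidiagonal in this basis.\<close>

lemma pCons_qbasis:
  "smult ((1 - q\<^sup>2)\<^sup>2) (pCons 0 (qbasis j)) =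
     smult ((1 - (q\<^sup>2) ^ j) * (1 - (q\<^sup>2) ^ Suc j) / (q\<^sup>2) ^ j) (qbasis j)
     - smult (1 / (q\<^sup>2) ^ j) (qbasis (Suc j))"
proof -
  have "smult ((1 - q\<^sup>2)\<^sup>2) (pCons 0 p) =
     smult ((1 - (q\<^sup>2) ^ j) * (1 - (q\<^sup>2) ^ Suc j) / (q\<^sup>2) ^ j) p
     - smult (1 / (q\<^sup>2) ^ j) (p * (1 - smult (q ^ (2 * j)) [:1 + q\<^sup>2, (1 - q\<^sup>2)\<^sup>2:] + [:q ^ (4 * j + 2):]))"
    (is "?L = ?R") for p :: "real poly"
  proof (rule poly_ext)
    fix x
    have q4: "q ^ (4 * j + 2) = ((q\<^sup>2) ^ j)\<^sup>2 * q\<^sup>2" "q ^ (2 * j) = (q\<^sup>2) ^ j"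
      by (simp_all add: power_add power_mult power2_eq_square[symmetric] flip: power_mult)
    have nz: "(q\<^sup>2) ^ j \<noteq> 0" using q_pos by simp
    show "poly ?L x = poly ?R x"
      unfolding q4 using nz by (simp add: field_simps power2_eq_square del: power_mult)
  qed
  then show ?thesis by (simp add: qbasis_def)
qed

lemma qcoef_0_right: "qcoef n 0 = 1"
  by (simp add: qcoef_def qpoch_def)

text \<open>This compares the coefficients at \<open>qbasis (Suc j)\<close> in
  \<open>p_poly_rec\<close>. At n = 0 truncation gives m = 0, harmless because the factor 1 - Q^n is
  then 0.\<close>

lemma qcoef_rec:
  assumes "m = n - 1"
  shows "(1 - (q\<^sup>2) ^ Suc n) * (qcoef (Suc n) (Suc j) - qcoef n (Suc j))
     - q\<^sup>2 * (1 - (q\<^sup>2) ^ n) * (qcoef n (Suc j) - qcoef m (Suc j))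
     = (1 - (q\<^sup>2) ^ Suc j) * (1 - (q\<^sup>2) ^ Suc (Suc j)) / (q\<^sup>2) ^ Suc j * qcoef n (Suc j)
       - qcoef n j / (q\<^sup>2) ^ j"
proof -
  define s where "s = q\<^sup>2"
  have s: "0 < s" "s < 1" using q2 by (auto simp: s_def)
  define A where "A = qpoch (1 / s ^ n) s j"
  define D where "D = qpoch s s j"
  have D0: "D \<noteq> 0" unfolding D_def qpoch_def
    using s by (auto simp: power_Suc2[symmetric] simp del: power_Suc2)
       (metis mult.commute power_Suc less_irrefl power_Suc_less_one)
  define x where "x = s ^ n"
  define y where "y = s ^ j"
  have y: "y \<noteq> 0" "1 - y * s \<noteq> 0" and x: "x \<noteq> 0"
    using s power_Suc_less_one[of s j] by (auto simp: x_def y_def mult.commute)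
  have 1: "qpoch (1 / s ^ n) s (Suc j) = A * (1 - y / x)"
    by (simp add: qpoch_Suc A_def x_def y_def)
  have 2: "qpoch (1 / s ^ Suc n) s (Suc j) = (1 - 1 / (x * s)) * A"
    using s by (simp add: qpoch_Suc_shift A_def x_def mult.commute)
  \<comment> \<open>Keeping the factor 1 - x avoids dividing by 1 - 1/x, which is 0 for n = 0; in
    that case both sides vanish.\<close>
  have 3: "(1 - x) * qpoch (1 / s ^ m) s (Suc j) = - x * (A * (1 - y / x) * (1 - y * s / x))"
  proof (cases n)
    case 0
    then show ?thesis
      by (cases j) (simp_all add: x_def A_def y_def qpoch_Suc_shift)
  next
    case (Suc k)
    have "qpoch (1 / s ^ n) s (Suc (Suc j)) = A * (1 - y / x) * (1 - y * s / x)"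
      by (simp add: qpoch_Suc A_def x_def y_def)
    moreover have "qpoch (1 / s ^ n) s (Suc (Suc j)) = (1 - 1 / x) * qpoch (1 / s ^ m) s (Suc j)"
      using s Suc assms by (simp add: qpoch_Suc_shift[of _ _ "Suc j"] x_def)
    moreover have "1 - x = - x * (1 - 1 / x)" using x by (simp add: field_simps)
    ultimately show ?thesis by simp
  qed
  have 4: "qpoch s s (Suc j) = D * (1 - y * s)"
    by (simp add: qpoch_Suc D_def y_def)
  have pw: "q ^ (2 * n) = s ^ n" "q ^ (2 * m) = s ^ m" "q ^ (2 * Suc n) = s ^ Suc n"
    "q ^ (2 * j) = y" "q ^ (2 * Suc j) = y * s" for n m
    unfolding s_def y_def power_mult by simp_all
  have e: "qcoef n (Suc j) = A * (1 - y / x) / (D * (1 - y * s))\<^sup>2 * (y * s)"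
    "qcoef (Suc n) (Suc j) = (1 - 1 / (x * s)) * A / (D * (1 - y * s))\<^sup>2 * (y * s)"
    "qcoef n j = A / D\<^sup>2 * y"
    unfolding qcoef_def pw s_def[symmetric] 1 2 4 A_def[symmetric] D_def[symmetric]
    by (simp_all add: y_def)
  have e3: "(1 - x) * qcoef m (Suc j) = - x * (A * (1 - y / x) * (1 - y * s / x)) / (D * (1 - y * s))\<^sup>2 * (y * s)"
    unfolding qcoef_def pw s_def[symmetric] 4 3[symmetric] by (simp add: y_def)
  have split: "s * (1 - x) * (u - w) = s * (1 - x) * u - s * ((1 - x) * w)" for u w
    by (simp add: algebra_simps)
  have pw2: "s ^ Suc n = x * s" "s ^ Suc j = y * s" "s ^ Suc (Suc j) = y * s * s" "s ^ n = x" "s ^ j = y"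
    by (simp_all add: x_def y_def mult_ac)
  show ?thesis
    unfolding s_def[symmetric] pw2 split e3 e
    using D0 y x s by (simp add: divide_simps power2_eq_square) (simp add: algebra_simps)
qed

theorem p_poly_rec:
  "smult (1 - (q\<^sup>2) ^ Suc n) (p_poly q (Suc n) - p_poly q n)
     - smult (q\<^sup>2 * (1 - (q\<^sup>2) ^ n)) (p_poly q n - p_poly q (n - 1))
   = smult ((1 - q\<^sup>2)\<^sup>2) (pCons 0 (p_poly q n))"
proof -
  let ?b = "\<lambda>j. (1 - (q\<^sup>2) ^ j) * (1 - (q\<^sup>2) ^ Suc j) / (q\<^sup>2) ^ j * qcoef n j"
  let ?l = "\<lambda>j. (1 - (q\<^sup>2) ^ Suc n) * (qcoef (Suc n) j - qcoef n j)
     - q\<^sup>2 * (1 - (q\<^sup>2) ^ n) * (qcoef n j - qcoef (n - 1) j)"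
  have "smult ((1 - q\<^sup>2)\<^sup>2) (pCons 0 (p_poly q n))
      = (\<Sum>j\<le>n. smult (qcoef n j) (smult ((1 - q\<^sup>2)\<^sup>2) (pCons 0 (qbasis j))))"
  proof -
    have "pCons 0 (\<Sum>j\<in>A. smult (f j) (qbasis j)) = (\<Sum>j\<in>A. smult (f j) (pCons 0 (qbasis j)))"
      for A :: "nat set" and f
      by (induction A rule: infinite_finite_induct) (simp_all add: pCons_add_0)
    then show ?thesis by (simp add: p_poly_eq smult_sum_right mult.commute)
  qed
  also have "\<dots> = (\<Sum>j\<le>n. smult (?b j) (qbasis j)) - (\<Sum>j\<le>n. smult (qcoef n j / (q\<^sup>2) ^ j) (qbasis (Suc j)))"
    unfolding pCons_qbasis by (simp add: smult_diff_right sum_subtractf mult.commute)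
  \<comment> \<open>The added term vanishes since \<open>qcoef n (Suc n)\<close> is 0; the j = 0
    term then drops out because of 1 - Q^0.\<close>
  also have "(\<Sum>j\<le>n. smult (?b j) (qbasis j)) = (\<Sum>j\<le>Suc n. smult (?b j) (qbasis j))"
    by (simp add: qcoef_eq_0)
  also have "\<dots> = (\<Sum>j\<le>n. smult (?b (Suc j)) (qbasis (Suc j)))"
    by (subst sum.atMost_Suc_shift) simp
  also have "\<dots> - (\<Sum>j\<le>n. smult (qcoef n j / (q\<^sup>2) ^ j) (qbasis (Suc j)))
      = (\<Sum>j\<le>n. smult (?l (Suc j)) (qbasis (Suc j)))"
    unfolding qcoef_rec[OF refl] by (simp add: smult_diff_left sum_subtractf)
  \<comment> \<open>The restored j = 0 term is 0, as \<open>qcoef\<close> has the value 1 there for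
    every n.\<close>
  also have "\<dots> = (\<Sum>j\<le>Suc n. smult (?l j) (qbasis j))"
    by (subst sum.atMost_Suc_shift) (simp add: qcoef_0_right)
  finally show ?thesis
    by (simp only: p_poly_bound[of n "Suc n"] p_poly_bound[of "n - 1" "Suc n"] p_poly_bound[of "Suc n" "Suc n"]
        smult_sum_right smult_smult smult_diff_left smult_diff_right sum_subtractf right_diff_distrib)
qed

end

section \<open>The \<open>Q\<close>-difference equation of the star product\<close>

text \<open>Complex coefficients give access to the ordinary ring of power series; the library
  product on \<open>pol fps\<close> is not the one studied here.\<close>

definition coef_fps :: "pol fps \<Rightarrow> nat \<Rightarrow> nat \<Rightarrow> complex fps" where
  "coef_fps F j k = Abs_fps (\<lambda>n. Poly_Mapping.lookup (F $ n) (j, k))"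

lemma scl_minus: "scl c (x - y) = scl c x - scl c y"
  by (rule poly_mapping_eqI) (simp add: lookup_minus algebra_simps)

lemma linear_to_mult_eqI:
  fixes f g :: "('a \<Rightarrow>\<^sub>0 complex) \<Rightarrow> complex"
  assumes "\<And>x y. f (x + y) = f x + f y" "\<And>c x. f (scl c x) = c * f x"
    and "\<And>x y. g (x + y) = g x + g y" "\<And>c x. g (scl c x) = c * g x"
    and "\<And>k. f (bas k) = g (bas k)"
  shows "f x = g x"
proof -
  have v: "vector_space ((*) :: complex \<Rightarrow> complex \<Rightarrow> complex)"
    by unfold_locales (auto simp: algebra_simps)
  have "f = g"
    by (rule linear_ext_bas[OF lin_alg_I[OF v] lin_alg_I[OF v]]) (simp_all only: assms)
  then show ?thesis by simp
qed

lemma linear_to_fps_eqI: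
  fixes f g :: "('a \<Rightarrow>\<^sub>0 complex) \<Rightarrow> complex fps"
  assumes "\<And>x y. f (x + y) = f x + f y" "\<And>c x. f (scl c x) = fps_const c * f x"
    and "\<And>x y. g (x + y) = g x + g y" "\<And>c x. g (scl c x) = fps_const c * g x"
    and "\<And>k. f (bas k) = g (bas k)"
  shows "f x = g x"
proof -
  have v: "vector_space (\<lambda>c (x :: complex fps). fps_const c * x)"
    by unfold_locales (simp_all add: fps_eq_iff algebra_simps)
  have "f = g"
    by (rule linear_ext_bas[OF lin_alg_I[OF v] lin_alg_I[OF v]]) (simp_all only: assms)
  then show ?thesis by simp
qed

text \<open>Along the diagonal (i - r, m - r) a pair (j, k) occurs at most once, at r = i - j; the
  bound on r keeps the truncated subtractions exact. This evaluates kernels of monomials.\<close>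

lemma sum_diagonal_delta:
  fixes h :: "nat \<Rightarrow> 'a::semiring_1"
  shows "(\<Sum>r\<le>min i m. h r * (if (j, k) = (i - r, m - r) then 1 else 0))
    = (if j \<le> i \<and> k \<le> m \<and> i - j = m - k then h (i - j) else 0)"
proof -
  have "(\<Sum>r\<le>min i m. h r * (if (j, k) = (i - r, m - r) then 1 else 0))
     = (\<Sum>r\<le>min i m. if r = i - j then (if j \<le> i \<and> k \<le> m \<and> i - j = m - k then h r else 0) else 0)"
  proof (rule sum.cong)
    fix r assume "r \<in> {..min i m}"
    then have "(j, k) = (i - r, m - r) \<longleftrightarrow> r = i - j \<and> j \<le> i \<and> k \<le> m \<and> i - j = m - k"
      unfolding prod.inject by auto
    then show "h r * (if (j, k) = (i - r, m - r) then 1 else 0)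
      = (if r = i - j then (if j \<le> i \<and> k \<le> m \<and> i - j = m - k then h r else 0) else 0)"
      by (simp only: if_distrib[of "(*) (h r)"] mult_1_right mult_zero_right split: if_split) blast
  qed simp
  also have "\<dots> = (if j \<le> i \<and> k \<le> m \<and> i - j = m - k then h (i - j) else 0)"
    by (subst sum.delta) auto
  finally show ?thesis .
qed

context quantum_disc
begin

definition Q :: complex where "Q = (of_real q)\<^sup>2"

lemma of_real_q: "of_real (q\<^sup>2) = Q" "of_real (q ^ (2 * n)) = Q ^ n"
  by (simp_all add: Q_def power_mult)

lemma Q_neq_0 [simp]: "Q \<noteq> 0"
  using q_pos by (simp add: Q_def)

lemma Q_power_neq_1 [simp]: "Q ^ Suc n \<noteq> 1" "1 \<noteq> Q ^ Suc n"
proof -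
  have "norm (Q ^ Suc n) = (q\<^sup>2) ^ Suc n"
    using q_pos by (simp only: norm_power Q_def) simp
  also have "\<dots> < 1"
    using q2 power_Suc_less_one by blast
  finally show "Q ^ Suc n \<noteq> 1" by auto
  then show "1 \<noteq> Q ^ Suc n" by metis
qed

lemma Q_neq_1 [simp]: "Q \<noteq> 1" "1 \<noteq> Q"
  using Q_power_neq_1[of 0] by auto

text \<open>Extends the coefficients of the star product to the whole tensor square, since
  \<open>qbox\<close> does not preserve pure tensors. At n = 0 the polynomial is p_0 = 1, as the
  truncated difference would be 0.\<close>

definition star_op :: "nat \<Rightarrow> pol2 \<Rightarrow> pol" where
  "star_op n v = m0 q (poly_op (if n = 0 then 1 else p_poly q n - p_poly q (n - 1)) (qbox q) v)"

lemma lin_star_op: "lin (star_op n)"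
  unfolding star_op_def[abs_def] by (intro lin_comp[OF lin_m0] lin_poly_op lin_qbox)

lemma star_op_0: "star_op 0 v = m0 q v"
  by (simp add: star_op_def poly_op_1)

lemma star_nth: "star q f g $ n = star_op n (tens f g)"
  by (simp add: star_def star_coeff_def star_op_0 m0_tens) (simp add: star_op_def)

lemma p_poly_0: "p_poly q 0 = 1"
  by (simp add: p_poly_def qpoch_def)

lemma m0_p_poly: "m0 q (poly_op (p_poly q n) (qbox q) v) = (\<Sum>i\<le>n. star_op i v)"
proof (induction n)
  case 0
  then show ?case by (simp add: p_poly_0 star_op_def)
next
  case (Suc n)
  have "p_poly q (Suc n) = p_poly q n + (p_poly q (Suc n) - p_poly q n)" by simp
  then have "m0 q (poly_op (p_poly q (Suc n)) (qbox q) v)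
      = m0 q (poly_op (p_poly q n) (qbox q) v) + m0 q (poly_op (p_poly q (Suc n) - p_poly q n) (qbox q) v)"
    by (metis poly_op_add lin_add[OF lin_m0])
  then show ?case using Suc by (simp add: star_op_def)
qed

text \<open>This is \<open>p_poly_rec\<close> with x replaced by the box operator; the factor p_n is
  a telescoping sum, which gives the sum over i.\<close>

lemma star_op_rec:
  "scl (1 - Q ^ Suc n) (star_op (Suc n) v) =
    scl (Q * (1 - Q ^ n)) (star_op n v) + scl ((1 - Q)\<^sup>2) (\<Sum>i\<le>n. star_op i (qbox q v))"
proof -
  let ?op = "\<lambda>p. m0 q (poly_op p (qbox q) v)"
  have "smult (1 - (q\<^sup>2) ^ Suc n) (p_poly q (Suc n) - p_poly q n)
     = smult (q\<^sup>2 * (1 - (q\<^sup>2) ^ n)) (p_poly q n - p_poly q (n - 1))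
       + smult ((1 - q\<^sup>2)\<^sup>2) (pCons 0 (p_poly q n))"
    using p_poly_rec[of n] by (simp add: algebra_simps)
  from arg_cong[OF this, of ?op]
  have *: "scl (of_real (1 - (q\<^sup>2) ^ Suc n)) (?op (p_poly q (Suc n) - p_poly q n))
     = scl (of_real (q\<^sup>2 * (1 - (q\<^sup>2) ^ n))) (?op (p_poly q n - p_poly q (n - 1)))
       + scl (of_real ((1 - q\<^sup>2)\<^sup>2)) (\<Sum>i\<le>n. star_op i (qbox q v))"
    by (simp only: poly_op_add poly_op_smult poly_op_pCons lin_add[OF lin_m0] lin_scl[OF lin_m0] m0_p_poly)
  have c: "complex_of_real (1 - (q\<^sup>2) ^ Suc n) = 1 - Q ^ Suc n"
    "complex_of_real (q\<^sup>2 * (1 - (q\<^sup>2) ^ n)) = Q * (1 - Q ^ n)"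
    "complex_of_real ((1 - q\<^sup>2)\<^sup>2) = (1 - Q)\<^sup>2"
    by (simp_all add: Q_def)
  have 1: "?op (p_poly q (Suc n) - p_poly q n) = star_op (Suc n) v"
    by (simp add: star_op_def)
  \<comment> \<open>At n = 0 the two operators differ, but the scalar 1 - Q^0 is 0.\<close>
  have 2: "scl (Q * (1 - Q ^ n)) (?op (p_poly q n - p_poly q (n - 1))) = scl (Q * (1 - Q ^ n)) (star_op n v)"
    by (cases n) (simp_all add: star_op_def scl_rules)
  show ?thesis using * unfolding c 1 2 .
qed

section \<open>The substitution t -> Q t and the difference equation of the generating
  series\<close>

definition qscale :: "complex fps \<Rightarrow> complex fps" where
  "qscale f = f oo (fps_const Q * fps_X)"

lemma qscale_nth [simp]: "qscale f $ n = Q ^ n * f $ n"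
  by (simp add: qscale_def fps_compose_linear)

lemma qscale_simps:
  "qscale (f + g) = qscale f + qscale g" "qscale (f - g) = qscale f - qscale g"
  "qscale (f * g) = qscale f * qscale g"
  "qscale (fps_const c) = fps_const c" "qscale fps_X = fps_const Q * fps_X"
  "qscale 1 = 1" "qscale 0 = 0"
  by (simp_all add: qscale_def fps_compose_add_distrib fps_compose_sub_distrib fps_compose_mult_distrib)

lemma qscale_sum: "qscale (\<Sum>i\<in>A. f i) = (\<Sum>i\<in>A. qscale (f i))"
  by (induction A rule: infinite_finite_induct) (simp_all add: qscale_simps)

lemma qscale_prod: "qscale (\<Prod>i\<in>A. f i) = (\<Prod>i\<in>A. qscale (f i))"
  by (induction A rule: infinite_finite_induct) (simp_all add: qscale_simps)

definition star_fps :: "pol2 \<Rightarrow> pol fps" where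
  "star_fps v = Abs_fps (\<lambda>n. star_op n v)"

lemma star_eq_star_fps: "star q f g = star_fps (tens f g)"
  by (simp add: fps_eq_iff star_nth star_fps_def)

text \<open>In the recurrence the partial sums over i amount to division by 1 - t, and the terms of
  index n and n + 1 combine into the factor 1 - Q t.\<close>

lemma coef_star_fps_qscale:
  "(1 - fps_X) * (1 - fps_const Q * fps_X) *
     (coef_fps (star_fps v) j k - qscale (coef_fps (star_fps v) j k))
   = fps_const ((1 - Q)\<^sup>2) * fps_X * coef_fps (star_fps (qbox q v)) j k"
proof -
  define u where "u n = Poly_Mapping.lookup (star_op n v) (j, k)" for n
  define w where "w n = Poly_Mapping.lookup (star_op n (qbox q v)) (j, k)" for n
  have rec: "(1 - Q ^ Suc n) * u (Suc n) = Q * (1 - Q ^ n) * u n + (1 - Q)\<^sup>2 * (\<Sum>i\<le>n. w i)" for n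
    using arg_cong[OF star_op_rec[of n v], of "\<lambda>f. Poly_Mapping.lookup f (j, k)"]
    unfolding u_def w_def lookup_scl lookup_add lookup_sum .
  have cu: "coef_fps (star_fps v) j k = Abs_fps u" and cw: "coef_fps (star_fps (qbox q v)) j k = Abs_fps w"
    by (simp_all add: coef_fps_def star_fps_def u_def w_def fps_eq_iff)
  have 1: "(1 - fps_const Q * fps_X) * (Abs_fps u - qscale (Abs_fps u))
      = fps_const ((1 - Q)\<^sup>2) * fps_X * Abs_fps (\<lambda>n. \<Sum>i\<le>n. w i)"
  proof (rule fps_ext)
    fix n
    show "((1 - fps_const Q * fps_X) * (Abs_fps u - qscale (Abs_fps u))) $ n
      = (fps_const ((1 - Q)\<^sup>2) * fps_X * Abs_fps (\<lambda>n. \<Sum>i\<le>n. w i)) $ n"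
      using rec[of "n - 1"] by (cases n) (simp_all add: algebra_simps mult.assoc)
  qed
  have 2: "(1 - fps_X) * Abs_fps (\<lambda>n. \<Sum>i\<le>n. w i) = Abs_fps w"
  proof (rule fps_ext)
    fix n
    show "((1 - fps_X) * Abs_fps (\<lambda>n. \<Sum>i\<le>n. w i)) $ n = Abs_fps w $ n"
      by (cases n) (simp_all add: algebra_simps)
  qed
  show ?thesis
    unfolding cu cw by (simp only: mult.assoc 1) (simp only: 2[symmetric] mult_ac)
qed

text \<open>The q-integer of k in base 1/Q, which appears as the factor when a partial derivative
  lowers an exponent.\<close>

definition qint :: "nat \<Rightarrow> complex" where
  "qint k = Q / Q ^ k * ((1 - Q ^ k) / (1 - Q))"

lemma qint_eq_sum: "qint k = (\<Sum>i<k. 1 / Q ^ i)"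
proof (induction k)
  case (Suc k)
  have "qint (Suc k) = qint k + 1 / Q ^ k"
    unfolding qint_def by (simp add: divide_simps) (simp add: algebra_simps)
  then show ?case using Suc by simp
qed (simp add: qint_def)

lemma qint_0 [simp]: "qint 0 = 0"
  by (simp add: qint_def)

lemma pmul_mon_z: "pmul q (mon i 0) (mon j k) = mon (i + j) k"
  by (simp add: pmul_mon lmul_z_pow)

lemma pmul_mon_zs: "pmul q (mon j i) (mon 0 k) = mon j (i + k)"
  by (simp add: pmul_mon lmul_zs_pow lmul_z_pow)

text \<open>Bringing dz to the left of z^i costs Q^(-i); these powers add up to
  \<open>qint j\<close>.\<close>

lemma dl_z_mon: "dl_z q (mon j k) = scl (qint j) (mon (j - 1) k)"
proof -
  have fst_sum: "fst (sum f A) = (\<Sum>i\<in>A. fst (f i))" for f :: "nat \<Rightarrow> omega" and A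
    by (induction A rule: infinite_finite_induct) auto
  have "dl_z q (mon j k) = (\<Sum>i<j. scl (1 / Q ^ i) (mon (j - 1) k))"
    by (simp add: dl_z_eq dif_mon fst_sum ract_def lact_def dz_def dzs_def twist_mon pmul_lin pmul_mon_z
        Q_def power_mult del: scl_single)
  then show ?thesis by (simp add: sum_scl qint_eq_sum del: scl_single)
qed

lemma dr_zs_mon: "dr_zs q (mon j k) = scl (qint k) (mon j (k - 1))"
proof -
  have q: "q \<noteq> 0" using q_pos by simp
  have snd_sum: "snd (sum f A) = (\<Sum>i\<in>A. snd (f i))" for f :: "nat \<Rightarrow> omega" and A
    by (induction A rule: infinite_finite_induct) auto
  have tw0: "twist r 0 = 0" for r by (simp add: twist_def lin_ext_def)
  have tw_sum: "twist r (sum f A) = (\<Sum>i\<in>A. twist r (f i))" for f :: "nat \<Rightarrow> pol" and A r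
    by (induction A rule: infinite_finite_induct) (auto simp: lin_add[OF lin_twist] tw0)
  have "dr_zs q (mon j k) = (\<Sum>i<k. scl (Q ^ i / Q ^ (k - 1)) (mon j (k - 1)))"
    using q
    by (simp add: dr_zs_eq dif_mon snd_sum ract_def lact_def dz_def dzs_def twist_mon pmul_lin pmul_mon_zs
        tw_sum lin_scl[OF lin_twist] scl_rules Q_def power_mult power_one_over field_simps del: scl_single)
      (simp add: power_mult[symmetric] mult.commute)
  \<comment> \<open>Reversing the sum counts the factors z* to the right of the differentiated one
    instead of those to its left.\<close>
  also have "\<dots> = (\<Sum>i<k. scl (1 / Q ^ i) (mon j (k - 1)))"
    by (subst sum.nat_diff_reindex[symmetric]) (auto intro!: sum.cong simp: power_diff)
  finally show ?thesis by (simp add: sum_scl qint_eq_sum del: scl_single)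
qed

lemma qbox_bas:
  "qbox q (bas ((a, b), (c, d))) = scl (qint b * qint c / Q)
     (bas ((a, b - 1), (c - 1, d)) - scl (1 + 1 / Q) (bas ((a, b), (c, d)))
      + scl (1 / Q) (bas ((a, Suc b), (Suc c, d))))"
proof -
  have minus: "tmul q (S - S') T = tmul q S T - tmul q S' T" "tmul q T (S - S') = tmul q T S - tmul q T S'"
    for S S' T
    using lin_add[OF lin_tmul_left[of q T], of "S - S'" S'] lin_add[OF lin_tmul_right[of q T], of "S - S'" S']
    by simp_all
  have z0: "tmul q 0 T = 0" "tmul q T 0 = 0" for T
    using minus(1)[of 0 0 T] minus(2)[of T 0 0] by simp_all
  note scl' = lin_scl[OF lin_tmul_left] lin_scl[OF lin_tmul_right] lin_scl[OF lin_tens_left] lin_scl[OF lin_tens_right]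
  have q: "q \<noteq> 0" using q_pos by simp
  have gz: "pmul q gen_zs gen_zs = mon 0 2" "pmul q gen_z gen_z = mon 2 0"
    by (simp_all add: gen_zs_def gen_z_def pmul_mon_z pmul_mon_zs numeral_2_eq_2)
  have *: "tmul q (tmul q (tens (mon a i) pone) (tens (mon 0 e) (mon e 0))) (tens pone (mon k d))
      = bas ((a, i + e), (e + k, d))" for i e k
    by (simp add: tmul_tens pmul_mon_z pmul_mon_zs del: tens_bas) simp
  have 0: "tens pone pone = tens (mon 0 0) (mon 0 0)" "tens gen_zs gen_z = tens (mon 0 1) (mon 1 0)"
    by (simp_all add: pone_def gen_zs_def gen_z_def)
  have "qbox q (bas ((a, b), (c, d))) = box_pure q (mon a b) (mon c d)"
    by (simp add: qbox_def)
  also have "\<dots> = scl (qint b * qint c / Q)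
     (bas ((a, b - 1 + 0), (0 + (c - 1), d)) - scl (1 + 1 / Q) (bas ((a, b - 1 + 1), (1 + (c - 1), d)))
      + scl (1 / Q) (bas ((a, b - 1 + 2), (2 + (c - 1), d))))"
    unfolding box_pure_def box_kernel_def dr_zs_mon dl_z_mon gz 0 scl' lin_add[OF lin_tmul_left]
      lin_add[OF lin_tmul_right] minus *
    by (simp add: scl_rules scl_minus Q_def mult_ac del: scl_single)
  \<comment> \<open>If b or c is 0 the scalar vanishes, so truncation of b - 1 and c - 1 does no
    harm.\<close>
  also have "\<dots> = scl (qint b * qint c / Q)
     (bas ((a, b - 1), (c - 1, d)) - scl (1 + 1 / Q) (bas ((a, b), (c, d)))
      + scl (1 / Q) (bas ((a, Suc b), (Suc c, d))))"
    by (cases b; cases c) (simp_all add: numeral_2_eq_2 scl_rules del: scl_single)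
  finally show ?thesis .
qed

end

section \<open>Kernels of products of monomials\<close>

text \<open>For I = Q^i, M = Q^m, N = Q^(i+b) this is the left side of
  \<open>inv_kweight_box\<close> with common factors removed.\<close>

lemma kernel_identity:
  fixes t Q I M N :: "'a::comm_ring_1"
  shows "(1 - Q * t) * (1 - Q * N * t) * (1 - N) - (1 - Q * I * t) * (1 - Q * M * t) * (1 - N)
      + Q * t * ((1 - I) * (1 - M)) * (1 - Q * N * t)
     = Q * t * (1 - Q * t) * ((N - I) * (N - M))"
  by (simp add: algebra_simps)

text \<open>With R = 1/Q and N = Q^(p+1) this is the combination of three consecutive
  \<open>inv_kweight\<close> in \<open>inv_kweight_box\<close>, over a common denominator.\<close>

lemma box_identity:
  fixes t Q R N :: "'a::comm_ring_1"
  assumes "R * Q = 1"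
  shows "(1 - N * t) * (1 - Q * N * t) - (1 + R) * ((1 - N) * (1 - Q * N * t)) + R * ((1 - N) * (1 - Q * N))
     = N * N * ((1 - Q * t) * (1 - t))"
proof -
  have "Q * (R * x) = x" for x using assms by (simp add: mult.assoc[symmetric] mult.commute)
  note 1 = this
  have 2: "Q * R = 1" using assms by (simp add: mult.commute)
  show ?thesis
    by (simp add: algebra_simps 1 2)
qed

text \<open>Since (1 - t)(1 - c t) = 1 - (1 + c) t + c t^2, the equation expresses coefficient n of
  f through lower coefficients of f and g.\<close>

lemma fps_nth_eq_0_of_shift:
  fixes f g :: "'a::comm_ring_1 fps"
  assumes "(1 - fps_X) * (1 - fps_const c * fps_X) * f = fps_X * g"
    and "\<And>l. l < n \<Longrightarrow> f $ l = 0" "\<And>l. l < n \<Longrightarrow> g $ l = 0" and "n > 0"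
  shows "f $ n = 0"
proof -
  have "f = fps_X * (g + fps_const (1 + c) * f - fps_X * (fps_const c * f))"
    unfolding right_diff_distrib distrib_left assms(1)[symmetric]
    by (simp add: algebra_simps flip: fps_const_add)
  then have "f $ n = (fps_X * (g + fps_const (1 + c) * f - fps_X * (fps_const c * f))) $ n"
    by metis
  also have "\<dots> = 0"
    using assms(2-4) by simp
  finally show ?thesis .
qed

section \<open>The weights (Q t; Q)_r / (Q; Q)_r and their inverses under t -> Q t\<close>

context quantum_disc
begin

definition qfac :: "nat \<Rightarrow> complex" where
  "qfac r = (\<Prod>i<r. 1 - Q ^ Suc i)"

definition tpoch :: "nat \<Rightarrow> complex fps" where
  "tpoch r = (\<Prod>i<r. 1 - fps_const (Q ^ Suc i) * fps_X)"

definition kweight :: "nat \<Rightarrow> complex fps" where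
  "kweight r = fps_const (inverse (qfac r)) * tpoch r"

definition inv_kweight :: "nat \<Rightarrow> complex fps" where
  "inv_kweight r = fps_const (qfac r) * inverse (tpoch r)"

lemma qfac_0 [simp]: "qfac 0 = 1" and qfac_Suc: "qfac (Suc r) = qfac r * (1 - Q ^ Suc r)"
  by (simp_all add: qfac_def)

lemma qfac_neq_0 [simp]: "qfac r \<noteq> 0"
  unfolding qfac_def prod_zero_iff[OF finite_lessThan] using Q_power_neq_1 by (metis eq_iff_diff_eq_0)

lemma tpoch_0 [simp]: "tpoch 0 = 1" and tpoch_Suc: "tpoch (Suc r) = tpoch r * (1 - fps_const (Q ^ Suc r) * fps_X)"
  by (simp_all add: tpoch_def)

lemma tpoch_nth_0 [simp]: "tpoch r $ 0 = 1"
  by (induction r) (simp_all add: tpoch_Suc)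

lemma tpoch_neq_0 [simp]: "tpoch r \<noteq> 0"
  by (metis tpoch_nth_0 fps_zero_nth zero_neq_one)

lemma linear_fps_neq_0 [simp]: "1 - fps_const c * fps_X \<noteq> (0 :: complex fps)"
proof
  assume "1 - fps_const c * fps_X = (0 :: complex fps)"
  from arg_cong[OF this, of "\<lambda>f. f $ 0"] show False by simp
qed

lemma kweight_nth_0: "kweight r $ 0 = inverse (qfac r)" and inv_kweight_nth_0: "inv_kweight r $ 0 = qfac r"
  by (simp_all add: kweight_def inv_kweight_def)

lemma kweight_0 [simp]: "kweight 0 = 1" and inv_kweight_0 [simp]: "inv_kweight 0 = 1"
  by (simp_all add: kweight_def inv_kweight_def)

lemma inverse_tpoch: "tpoch r * inverse (tpoch r) = 1"
  by (rule inverse_mult_eq_1') simp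

lemma kweight_inv_kweight: "kweight r * inv_kweight r = 1"
proof -
  have "kweight r * inv_kweight r = fps_const (inverse (qfac r) * qfac r) * (tpoch r * inverse (tpoch r))"
    unfolding kweight_def inv_kweight_def fps_const_mult[symmetric] by (simp only: mult_ac)
  then show ?thesis by (simp add: inverse_tpoch)
qed

lemma kweight_Suc: "kweight (Suc r) * fps_const (1 - Q ^ Suc r) = kweight r * (1 - fps_const (Q ^ Suc r) * fps_X)"
proof -
  have "kweight (Suc r) * fps_const (1 - Q ^ Suc r)
     = fps_const (inverse (qfac (Suc r)) * (1 - Q ^ Suc r)) * tpoch (Suc r)"
    unfolding kweight_def fps_const_mult[symmetric] by (simp only: mult_ac)
  also have "inverse (qfac (Suc r)) * (1 - Q ^ Suc r) = inverse (qfac r)"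
    using Q_power_neq_1[of r] by (simp add: qfac_Suc del: power_Suc)
  finally show ?thesis by (simp add: tpoch_Suc kweight_def mult_ac)
qed

text \<open>The substitution yields (Q^2 t; Q)_r, and 1 - Q t restores the missing first
  factor.\<close>

lemma qscale_tpoch: "(1 - fps_const Q * fps_X) * qscale (tpoch r) = tpoch (Suc r)"
proof -
  have "qscale (tpoch r) = (\<Prod>i<r. 1 - fps_const (Q ^ Suc (Suc i)) * fps_X)"
    unfolding tpoch_def qscale_prod
    by (rule prod.cong) (simp_all add: qscale_simps mult_ac flip: fps_const_mult)
  then show ?thesis
    unfolding tpoch_def by (subst prod.lessThan_Suc_shift) simp
qed

lemma qscale_kweight:
  "(1 - fps_const Q * fps_X) * qscale (kweight r) = kweight r * (1 - fps_const (Q ^ Suc r) * fps_X)"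
proof -
  have "(1 - fps_const Q * fps_X) * qscale (kweight r)
      = fps_const (inverse (qfac r)) * ((1 - fps_const Q * fps_X) * qscale (tpoch r))"
    unfolding kweight_def qscale_simps by (simp only: mult_ac)
  also have "\<dots> = kweight r * (1 - fps_const (Q ^ Suc r) * fps_X)"
    unfolding qscale_tpoch tpoch_Suc kweight_def by (simp only: mult_ac)
  finally show ?thesis .
qed

lemma qscale_kweight':
  "(1 - fps_const Q * fps_X) * qscale (kweight r) = kweight (Suc r) * fps_const (1 - Q ^ Suc r)"
  by (simp only: qscale_kweight kweight_Suc)

text \<open>Needed where t -> Q t is applied to the coefficients of a series but not to the weights.
  The two sides are compared after multiplication by 1 - Q t.\<close>

lemma kweight_eq_qscale: "kweight (Suc r) = qscale (kweight (Suc r)) - fps_const Q * fps_X * qscale (kweight r)"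
proof -
  let ?v = "1 - fps_const Q * fps_X"
  have "?v * (qscale (kweight (Suc r)) - fps_const Q * fps_X * qscale (kweight r))
     = ?v * qscale (kweight (Suc r)) - fps_const Q * fps_X * (?v * qscale (kweight r))"
    by (simp add: algebra_simps)
  also have "\<dots> = ?v * kweight (Suc r)"
    unfolding qscale_kweight[of "Suc r"] qscale_kweight'[of r]
    by (simp add: algebra_simps flip: fps_const_sub fps_const_mult)
  finally show ?thesis
    using linear_fps_neq_0 mult_left_cancel by metis
qed

lemma qscale_inv_kweight:
  "(1 - fps_const (Q ^ Suc r) * fps_X) * qscale (inv_kweight r) = inv_kweight r * (1 - fps_const Q * fps_X)"
proof -
  have 1: "qscale (kweight r) * qscale (inv_kweight r) = 1"
    by (simp add: kweight_inv_kweight qscale_simps flip: qscale_simps(3))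
  have "(1 - fps_const (Q ^ Suc r) * fps_X) * qscale (inv_kweight r)
     = inv_kweight r * (kweight r * (1 - fps_const (Q ^ Suc r) * fps_X)) * qscale (inv_kweight r)"
    using kweight_inv_kweight[of r] by (simp add: mult_ac)
  also have "\<dots> = inv_kweight r * (1 - fps_const Q * fps_X) * (qscale (kweight r) * qscale (inv_kweight r))"
    unfolding qscale_kweight[symmetric] by (simp only: mult_ac)
  finally show ?thesis by (simp add: 1)
qed

lemma inv_kweight_factor:
  obtains g where
    "inv_kweight p = g * ((1 - fps_const (Q ^ Suc p) * fps_X) * (1 - fps_const Q * fps_const (Q ^ Suc p) * fps_X))"
    "inv_kweight (Suc p) = g * ((1 - fps_const (Q ^ Suc p)) * (1 - fps_const Q * fps_const (Q ^ Suc p) * fps_X))"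
    "inv_kweight (Suc (Suc p)) = g * ((1 - fps_const (Q ^ Suc p)) * (1 - fps_const Q * fps_const (Q ^ Suc p)))"
proof
  \<comment> \<open>The witness is (Q; Q)_p / (Q t; Q)_(p+2), whose denominator is common to all
    three inverse weights.\<close>
  let ?g = "fps_const (qfac p) * inverse (tpoch (Suc (Suc p)))"
  let ?A = "1 - fps_const (Q ^ Suc p) * fps_X"
  let ?B = "1 - fps_const Q * fps_const (Q ^ Suc p) * fps_X"
  have t1: "tpoch (Suc p) = tpoch p * ?A" and t2: "tpoch (Suc (Suc p)) = tpoch (Suc p) * ?B"
    by (simp_all add: tpoch_Suc mult_ac)
  have i1: "inverse (tpoch (Suc p)) = inverse (tpoch (Suc (Suc p))) * ?B"
  proof -
    have "tpoch (Suc p) * inverse (tpoch (Suc p)) = tpoch (Suc p) * (inverse (tpoch (Suc (Suc p))) * ?B)"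
      using inverse_tpoch[of "Suc (Suc p)"] unfolding inverse_tpoch t2 by (simp only: mult_ac)
    then show ?thesis by simp
  qed
  have i0: "inverse (tpoch p) = inverse (tpoch (Suc p)) * ?A"
  proof -
    have "tpoch p * inverse (tpoch p) = tpoch p * (inverse (tpoch (Suc p)) * ?A)"
      using inverse_tpoch[of "Suc p"] unfolding inverse_tpoch t1 by (simp only: mult_ac)
    then show ?thesis by simp
  qed
  show "inv_kweight p = ?g * (?A * ?B)"
    unfolding inv_kweight_def i0 i1 by (simp only: mult_ac)
  show "inv_kweight (Suc p) = ?g * ((1 - fps_const (Q ^ Suc p)) * ?B)"
    unfolding inv_kweight_def i1 qfac_Suc
    by (simp add: mult_ac flip: fps_const_sub fps_const_mult del: power_Suc)
  show "inv_kweight (Suc (Suc p)) = ?g * ((1 - fps_const (Q ^ Suc p)) * (1 - fps_const Q * fps_const (Q ^ Suc p)))"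
    unfolding inv_kweight_def qfac_Suc power_Suc[of Q "Suc p"]
    by (simp only: mult_ac fps_const_mult[symmetric] fps_const_sub[symmetric] fps_const_1_eq_1)
qed

lemma inv_kweight_qscale_factor:
  obtains g where
    "inv_kweight p = g * ((1 - fps_const (Q ^ Suc p) * fps_X) * (1 - fps_const Q * fps_const (Q ^ Suc p) * fps_X))"
    "inv_kweight (Suc p) = g * ((1 - fps_const (Q ^ Suc p)) * (1 - fps_const Q * fps_const (Q ^ Suc p) * fps_X))"
    "inv_kweight (Suc (Suc p)) = g * ((1 - fps_const (Q ^ Suc p)) * (1 - fps_const Q * fps_const (Q ^ Suc p)))"
    "qscale (inv_kweight p) = g * ((1 - fps_const Q * fps_const (Q ^ Suc p) * fps_X) * (1 - fps_const Q * fps_X))"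
    "qscale (inv_kweight (Suc p)) = g * ((1 - fps_const (Q ^ Suc p)) * (1 - fps_const Q * fps_X))"
proof -
  obtain g where g: "inv_kweight p = g * ((1 - fps_const (Q ^ Suc p) * fps_X) * (1 - fps_const Q * fps_const (Q ^ Suc p) * fps_X))"
    "inv_kweight (Suc p) = g * ((1 - fps_const (Q ^ Suc p)) * (1 - fps_const Q * fps_const (Q ^ Suc p) * fps_X))"
    "inv_kweight (Suc (Suc p)) = g * ((1 - fps_const (Q ^ Suc p)) * (1 - fps_const Q * fps_const (Q ^ Suc p)))"
    by (rule inv_kweight_factor)
  have "(1 - fps_const (Q ^ Suc p) * fps_X) * qscale (inv_kweight p)
     = (1 - fps_const (Q ^ Suc p) * fps_X) *
        (g * ((1 - fps_const Q * fps_const (Q ^ Suc p) * fps_X) * (1 - fps_const Q * fps_X)))"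
    by (subst qscale_inv_kweight) (simp only: g mult_ac)
  then have 4: "qscale (inv_kweight p) = g * ((1 - fps_const Q * fps_const (Q ^ Suc p) * fps_X) * (1 - fps_const Q * fps_X))"
    using linear_fps_neq_0 mult_left_cancel by blast
  have "(1 - fps_const (Q ^ Suc (Suc p)) * fps_X) * qscale (inv_kweight (Suc p))
     = (1 - fps_const (Q ^ Suc (Suc p)) * fps_X) *
        (g * ((1 - fps_const (Q ^ Suc p)) * (1 - fps_const Q * fps_X)))"
    by (subst qscale_inv_kweight) (simp only: g power_Suc[of Q "Suc p"] fps_const_mult[symmetric] mult_ac)
  then have "qscale (inv_kweight (Suc p)) = g * ((1 - fps_const (Q ^ Suc p)) * (1 - fps_const Q * fps_X))"
    using linear_fps_neq_0 mult_left_cancel by blast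
  with g 4 show ?thesis by (rule that)
qed

text \<open>From N - I = -I (1 - Q^b), N - M = -M (1 - Q^c) and N^2 = I M Q^(b+c). It links the
  scalar of \<open>qbox_bas\<close> to the right side of \<open>kernel_identity\<close>.\<close>

lemma qint_mult:
  assumes "I * Q ^ b = N" "M * Q ^ c = N"
  shows "(1 - Q)\<^sup>2 * (qint b * qint c / Q) * (N * N) = Q * ((N - I) * (N - M))"
proof -
  have 1: "(1 - Q)\<^sup>2 * (qint b * qint c / Q) = Q / (Q ^ b * Q ^ c) * ((1 - Q ^ b) * (1 - Q ^ c))"
    by (simp add: qint_def power2_eq_square)
  have 2: "N * N = (I * M) * (Q ^ b * Q ^ c)"
    using assms by (simp add: mult_ac flip: assms)
  have 3: "(N - I) * (N - M) = (I * M) * ((1 - Q ^ b) * (1 - Q ^ c))"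
  proof -
    have "(N - I) * (N - M) = (I * Q ^ b - I) * (M * Q ^ c - M)" by (simp only: assms)
    then show ?thesis by (simp add: algebra_simps)
  qed
  have "(1 - Q)\<^sup>2 * (qint b * qint c / Q) * (N * N)
    = Q / (Q ^ b * Q ^ c) * ((1 - Q ^ b) * (1 - Q ^ c)) * (I * M * (Q ^ b * Q ^ c))"
    by (simp only: 1 2)
  also have "\<dots> = Q * ((N - I) * (N - M))"
    unfolding 3 by simp
  finally show ?thesis .
qed

text \<open>The difference equation for one entry of a matrix product, with i + b = m + c as
  intermediate index. The term from the diagonal predecessor is the correction arising in
  \<open>sum_kweight_qscale\<close>.\<close>

lemma inv_kweight_box:
  assumes N: "i + b = m + c"
  shows "(1 - fps_X) * (1 - fps_const Q * fps_X) *
     (kweight i * kweight m * inv_kweight (i + b) - qscale (kweight i * kweight m * inv_kweight (i + b))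
      + fps_const Q * fps_X * qscale (if i = 0 \<or> m = 0 then 0 else kweight (i - 1) * kweight (m - 1) * inv_kweight (i + b - 1)))
    = fps_X * (fps_const ((1 - Q)\<^sup>2 * (qint b * qint c / Q)) * (kweight i * kweight m *
       (inv_kweight (i + b - 1) - fps_const (1 + 1 / Q) * inv_kweight (i + b) + fps_const (1 / Q) * inv_kweight (Suc (i + b)))))"
proof (cases "i + b")
  case 0
  then show ?thesis using N by (simp add: qscale_simps)
next
  case (Suc p)
  define t where "t = (fps_X :: complex fps)"
  define s where "s = fps_const Q"
  define I where "I = fps_const (Q ^ i)"
  define M where "M = fps_const (Q ^ m)"
  define n where "n = fps_const (Q ^ Suc p)"
  define v where "v = 1 - s * t"
  define K where "K = fps_const ((1 - Q)\<^sup>2 * (qint b * qint c / Q))"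
  define R where "R = fps_const (1 / Q)"
  define x where "x = kweight i"
  define y where "y = kweight m"
  have v0: "v \<noteq> 0" unfolding v_def s_def t_def by (rule linear_fps_neq_0)
  obtain g where
    "inv_kweight p = g * ((1 - n * t) * (1 - s * n * t))"
    "inv_kweight (Suc p) = g * ((1 - n) * (1 - s * n * t))"
    "inv_kweight (Suc (Suc p)) = g * ((1 - n) * (1 - s * n))"
    "qscale (inv_kweight p) = g * ((1 - s * n * t) * v)"
    "qscale (inv_kweight (Suc p)) = g * ((1 - n) * v)"
    unfolding n_def s_def t_def v_def by (rule inv_kweight_qscale_factor)
  note g = this
  have x1: "v * qscale x = x * (1 - s * I * t)" and y1: "v * qscale y = y * (1 - s * M * t)"
    using qscale_kweight[of i] qscale_kweight[of m]
    by (simp_all add: x_def y_def v_def s_def t_def I_def M_def)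
  \<comment> \<open>If i = 0 or m = 0 then (1 - I)(1 - M) = 0, so one formula covers all
    cases.\<close>
  have tau: "v * v * qscale (if i = 0 \<or> m = 0 then 0 else kweight (i - 1) * kweight (m - 1) * inv_kweight p)
      = (x * y) * ((1 - I) * (1 - M)) * (g * ((1 - s * n * t) * v))"
  proof (cases "i = 0 \<or> m = 0")
    case True
    then show ?thesis by (auto simp: I_def M_def qscale_simps)
  next
    case False
    then obtain i' m' where [simp]: "i = Suc i'" "m = Suc m'" by (metis not0_implies_Suc)
    have "v * v * qscale (kweight i' * kweight m' * inv_kweight p) = (v * qscale (kweight i')) * (v * qscale (kweight m')) * qscale (inv_kweight p)"
      by (simp add: qscale_simps mult_ac)
    also have "v * qscale (kweight i') = x * (1 - I)"
      using qscale_kweight'[of i'] by (simp add: x_def v_def s_def t_def I_def flip: fps_const_sub)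
    also have "v * qscale (kweight m') = y * (1 - M)"
      using qscale_kweight'[of m'] by (simp add: y_def v_def s_def t_def M_def flip: fps_const_sub)
    finally show ?thesis by (simp add: g(4) mult_ac)
  qed
  have Kn: "K * (n * n) = s * ((n - I) * (n - M))"
  proof -
    have "Q ^ i * Q ^ b = Q ^ Suc p" "Q ^ m * Q ^ c = Q ^ Suc p"
      using Suc N by (simp_all add: power_add[symmetric] del: power_Suc)
    from qint_mult[OF this] show ?thesis
      by (simp add: K_def n_def s_def I_def M_def del: power_Suc)
  qed
  have R: "R * s = 1" by (simp add: R_def s_def)
  define tau where "tau = (if i = 0 \<or> m = 0 then 0 else kweight (i - 1) * kweight (m - 1) * inv_kweight p)"
  \<comment> \<open>Multiplication by \<open>v * v\<close> clears the denominators of the two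
    shifted weights; it is cancelled at the end.\<close>
  have "v * v * ((1 - t) * v * (x * y * inv_kweight (Suc p) - qscale (x * y * inv_kweight (Suc p)) + s * t * qscale tau))
     = (1 - t) * v * (v * v * (x * y) * inv_kweight (Suc p) - (v * qscale x) * (v * qscale y) * qscale (inv_kweight (Suc p))
       + s * t * (v * v * qscale tau))"
    by (simp add: qscale_simps algebra_simps)
  also have "\<dots> = (1 - t) * v * (x * y * g * v * (v * (1 - s * n * t) * (1 - n)
       - (1 - s * I * t) * (1 - s * M * t) * (1 - n) + s * t * ((1 - I) * (1 - M)) * (1 - s * n * t)))"
    unfolding tau[folded tau_def] x1 y1 g(5) unfolding g(2) by (simp add: algebra_simps)
  also have "\<dots> = (1 - t) * v * (x * y * g * v * (s * t * v * ((n - I) * (n - M))))"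
    unfolding v_def kernel_identity ..
  \<comment> \<open>\<open>Kn\<close> trades (n - I)(n - M) for n^2, which
    \<open>box_identity\<close> turns into the three inverse weights.\<close>
  also have "\<dots> = v * v * (t * (K * (x * y * (g * (n * n * (v * (1 - t)))))))"
    using Kn by (simp add: mult_ac)
  also have "g * (n * n * (v * (1 - t))) = inv_kweight p - (1 + R) * inv_kweight (Suc p) + R * inv_kweight (Suc (Suc p))"
    unfolding v_def box_identity[OF R, symmetric] g by (simp add: algebra_simps)
  finally have "(1 - t) * v * (x * y * inv_kweight (Suc p) - qscale (x * y * inv_kweight (Suc p)) + s * t * qscale tau)
     = t * (K * (x * y * (inv_kweight p - (1 + R) * inv_kweight (Suc p) + R * inv_kweight (Suc (Suc p)))))"
    using v0 by simp
  moreover have "fps_const (1 + 1 / Q) = 1 + R" by (simp add: R_def flip: fps_const_add)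
  ultimately show ?thesis
    unfolding Suc diff_Suc_1 tau_def x_def y_def v_def s_def t_def K_def R_def by (simp only:)
qed

text \<open>Entry (i, m) of the weighted matrix product of the kernels of z^a z*^b and z^c z*^d; the
  only possible intermediate index is i - a + b = m - d + c.\<close>

definition ker_prod :: "nat \<Rightarrow> nat \<Rightarrow> nat \<Rightarrow> nat \<Rightarrow> nat \<Rightarrow> nat \<Rightarrow> complex fps" where
  "ker_prod a b c d i m = (if a \<le> i \<and> d \<le> m \<and> i - a + b = m - d + c
     then kweight (i - a) * kweight (m - d) * inv_kweight (i - a + b) else 0)"

lemma ker_prod_box:
  "(1 - fps_X) * (1 - fps_const Q * fps_X) *
     (ker_prod a b c d i m - qscale (ker_prod a b c d i m)
      + fps_const Q * fps_X * (if i = 0 \<or> m = 0 then 0 else qscale (ker_prod a b c d (i - 1) (m - 1))))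
    = fps_X * (fps_const ((1 - Q)\<^sup>2 * (qint b * qint c / Q)) *
       (ker_prod a (b - 1) (c - 1) d i m - fps_const (1 + 1 / Q) * ker_prod a b c d i m
        + fps_const (1 / Q) * ker_prod a (Suc b) (Suc c) d i m))"
proof (cases "a \<le> i \<and> d \<le> m \<and> i - a + b = m - d + c")
  case True
  then obtain i' m' where im: "i = a + i'" "m = d + m'" by (metis le_Suc_ex)
  have eq: "i' + b = m' + c" using True im by simp
  have 1: "ker_prod a b c d i m = kweight i' * kweight m' * inv_kweight (i' + b)"
    "ker_prod a (Suc b) (Suc c) d i m = kweight i' * kweight m' * inv_kweight (Suc (i' + b))"
    using eq by (simp_all add: ker_prod_def im)
  \<comment> \<open>For i' = 0 or m' = 0 the predecessor lies outside the support of
    \<open>ker_prod\<close>, in agreement with the 0 on the right.\<close>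
  have 2: "(if i = 0 \<or> m = 0 then 0 else qscale (ker_prod a b c d (i - 1) (m - 1)))
     = qscale (if i' = 0 \<or> m' = 0 then 0 else kweight (i' - 1) * kweight (m' - 1) * inv_kweight (i' + b - 1))"
    using eq by (cases i'; cases m') (auto simp: ker_prod_def im qscale_simps)
  \<comment> \<open>For b = 0 or c = 0 the truncated entries may differ, but the scalar is
    0.\<close>
  have 3: "fps_const ((1 - Q)\<^sup>2 * (qint b * qint c / Q)) * (ker_prod a (b - 1) (c - 1) d i m + w)
    = fps_const ((1 - Q)\<^sup>2 * (qint b * qint c / Q)) * (kweight i' * kweight m' * inv_kweight (i' + b - 1) + w)" for w
    using eq by (cases b; cases c) (auto simp: ker_prod_def im)
  have 4: "x - y + z = x + (z - y)" for x y z :: "complex fps" by simp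
  show ?thesis
    using inv_kweight_box[OF eq] unfolding 1 2 4[of "ker_prod _ _ _ _ _ _"] 3
    by (simp add: algebra_simps)
next
  case False
  then have "ker_prod a b c d i m = 0" "ker_prod a (Suc b) (Suc c) d i m = 0"
    "i \<noteq> 0 \<Longrightarrow> m \<noteq> 0 \<Longrightarrow> ker_prod a b c d (i - 1) (m - 1) = 0"
    "b \<noteq> 0 \<Longrightarrow> c \<noteq> 0 \<Longrightarrow> ker_prod a (b - 1) (c - 1) d i m = 0"
    by (auto simp: ker_prod_def)
  then show ?thesis by (cases "b = 0 \<or> c = 0") (auto simp: qscale_simps)
qed

lemma ker_prod_nth_0:
  "ker_prod a b c d i m $ 0 = (if a \<le> i \<and> d \<le> m \<and> i - a + b = m - d + c
     then qfac (i - a + b) / (qfac (i - a) * qfac (m - d)) else 0)"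
  unfolding ker_prod_def if_distrib[of "\<lambda>f. f $ 0"]
  by (rule if_cong[OF refl]) (simp_all add: kweight_nth_0 inv_kweight_nth_0 divide_inverse mult_ac)

end

section \<open>Kernels of star products\<close>

lemma lin_sum: "(\<And>i. i \<in> A \<Longrightarrow> lin (f i)) \<Longrightarrow> lin (\<lambda>x. \<Sum>i\<in>A. f i x)"
proof (induction A rule: infinite_finite_induct)
  case (insert x F)
  then show ?case by (simp add: lin_plus)
qed (auto intro!: linI simp: scl_rules)

text \<open>The sum over k of t^k times A k, which converges t-adically for every A.\<close>

definition adic_sum :: "(nat \<Rightarrow> 'a::comm_monoid_add fps) \<Rightarrow> 'a fps" where
  "adic_sum A = Abs_fps (\<lambda>n. \<Sum>k\<le>n. A k $ (n - k))"

lemma adic_sum_mult: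
  fixes c :: "'a::comm_ring_1 fps"
  shows "adic_sum (\<lambda>k. c * A k) = c * adic_sum A"
proof (rule fps_ext)
  fix n
  have "adic_sum (\<lambda>k. c * A k) $ n = (\<Sum>k\<le>n. \<Sum>l\<le>n - k. c $ l * A k $ (n - k - l))"
    by (simp add: adic_sum_def fps_mult_nth atLeast0AtMost)
  also have "\<dots> = (\<Sum>(k, l)\<in>(SIGMA k:{..n}. {..n - k}). c $ l * A k $ (n - k - l))"
    by (rule sum.Sigma) auto
  also have "\<dots> = (\<Sum>(l, k)\<in>(SIGMA l:{..n}. {..n - l}). c $ l * A k $ (n - l - k))"
    by (rule sum.reindex_bij_witness[of _ "\<lambda>(l, k). (k, l)" "\<lambda>(k, l). (l, k)"]) (auto simp: add.commute)
  also have "\<dots> = (\<Sum>l\<le>n. \<Sum>k\<le>n - l. c $ l * A k $ (n - l - k))"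
    by (rule sum.Sigma[symmetric]) auto
  also have "\<dots> = (c * adic_sum A) $ n"
    by (simp add: adic_sum_def fps_mult_nth atLeast0AtMost sum_distrib_left)
  finally show "adic_sum (\<lambda>k. c * A k) $ n = (c * adic_sum A) $ n" .
qed

lemma fps_nth_sum: "(\<Sum>i\<in>I. f i) $ n = (\<Sum>i\<in>I. f i $ n)"
  for f :: "'b \<Rightarrow> 'a::comm_monoid_add fps"
  by (induction I rule: infinite_finite_induct) simp_all

lemma adic_sum_sum:
  fixes A :: "nat \<Rightarrow> 'b \<Rightarrow> 'a::comm_ring_1 fps"
  shows "adic_sum (\<lambda>k. \<Sum>i\<in>I. A k i) = (\<Sum>i\<in>I. adic_sum (\<lambda>k. A k i))"
proof (rule fps_ext)
  fix n
  show "adic_sum (\<lambda>k. \<Sum>i\<in>I. A k i) $ n = (\<Sum>i\<in>I. adic_sum (\<lambda>k. A k i)) $ n"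
    unfolding fps_nth_sum adic_sum_def fps_nth_Abs_fps by (rule sum.swap)
qed

lemma adic_sum_0: "adic_sum (\<lambda>k. 0) = 0"
  by (simp add: adic_sum_def fps_eq_iff)

lemma adic_sum_const:
  fixes a :: "nat \<Rightarrow> 'a::comm_ring_1"
  shows "adic_sum (\<lambda>k. fps_const (a k)) = Abs_fps a"
proof (rule fps_ext)
  fix n
  have "adic_sum (\<lambda>k. fps_const (a k)) $ n = (\<Sum>k\<le>n. if k = n then a k else 0)"
    unfolding adic_sum_def fps_nth_Abs_fps by (rule sum.cong) auto
  then show "adic_sum (\<lambda>k. fps_const (a k)) $ n = Abs_fps a $ n" by simp
qed

section \<open>Kernels of polynomials and of power series\<close>

context quantum_disc
begin

text \<open>The coefficient of z^i w^m in the kernel: exactly the monomials on the diagonal through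
  (i, m) can contribute.\<close>

definition kernel :: "pol fps \<Rightarrow> nat \<Rightarrow> nat \<Rightarrow> complex fps" where
  "kernel F i m = (\<Sum>r\<le>min i m. kweight r * coef_fps F (i - r) (m - r))"

definition kernel_pol :: "pol \<Rightarrow> nat \<Rightarrow> nat \<Rightarrow> complex fps" where
  "kernel_pol f i m = (\<Sum>r\<le>min i m. kweight r * fps_const (Poly_Mapping.lookup f (i - r, m - r)))"

text \<open>The kernel at t = 0, where \<open>kweight r\<close> becomes 1 / (Q; Q)_r.\<close>

definition kernel0 :: "pol \<Rightarrow> nat \<Rightarrow> nat \<Rightarrow> complex" where
  "kernel0 f i m = (\<Sum>r\<le>min i m. inverse (qfac r) * Poly_Mapping.lookup f (i - r, m - r))"

text \<open>Along each diagonal the system is triangular with leading weight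
  \<open>kweight 0\<close> = 1, so induction on i recovers the coefficients.\<close>

lemma kernel_inject:
  assumes "\<And>i m. kernel F i m = kernel G i m"
  shows "F = G"
proof -
  have split: "kernel F i m = coef_fps F i m + (\<Sum>r\<in>{1..min i m}. kweight r * coef_fps F (i - r) (m - r))" for F i m
  proof -
    have "{..min i m} = insert 0 {1..min i m}" by auto
    then show ?thesis by (simp add: kernel_def)
  qed
  have "coef_fps F i m = coef_fps G i m" for i m
  proof (induction i arbitrary: m rule: less_induct)
    case (less i)
    have "(\<Sum>r\<in>{1..min i m}. kweight r * coef_fps F (i - r) (m - r))
        = (\<Sum>r\<in>{1..min i m}. kweight r * coef_fps G (i - r) (m - r))"
      by (rule sum.cong) (auto simp: less)
    then show ?case using assms[of i m] by (simp add: split)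
  qed
  then have "Poly_Mapping.lookup (F $ n) (i, m) = Poly_Mapping.lookup (G $ n) (i, m)" for n i m
    by (simp add: coef_fps_def fps_eq_iff)
  then show ?thesis
    by (auto intro!: fps_ext poly_mapping_eqI)
qed

lemma coef_fps_star_fps:
  "coef_fps (star_fps (u + v)) j k = coef_fps (star_fps u) j k + coef_fps (star_fps v) j k"
  "coef_fps (star_fps (scl x v)) j k = fps_const x * coef_fps (star_fps v) j k"
  by (simp_all add: fps_eq_iff coef_fps_def star_fps_def lin_add[OF lin_star_op] lin_scl[OF lin_star_op] lookup_add)

lemma kernel_star_fps:
  "kernel (star_fps (u + v)) i m = kernel (star_fps u) i m + kernel (star_fps v) i m"
  "kernel (star_fps (scl x v)) i m = fps_const x * kernel (star_fps v) i m"
  by (simp_all add: kernel_def coef_fps_star_fps sum.distrib distrib_left sum_distrib_left mult_ac)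

lemma kernel_star_fps_diff:
  "kernel (star_fps (u - v)) i m = kernel (star_fps u) i m - kernel (star_fps v) i m"
  using kernel_star_fps(1)[of "u - v" v i m] by simp

text \<open>By \<open>kweight_eq_qscale\<close> the unshifted weights split into shifted ones for
  the same entry and for its diagonal predecessor.\<close>

lemma sum_kweight_qscale:
  "(\<Sum>r\<le>min i m. kweight r * qscale (coef_fps F (i - r) (m - r)))
    = qscale (kernel F i m) - fps_const Q * fps_X * (if i = 0 \<or> m = 0 then 0 else qscale (kernel F (i - 1) (m - 1)))"
proof (cases "i = 0 \<or> m = 0")
  case True
  then have "min i m = 0" by auto
  then show ?thesis using True by (simp add: kernel_def)
next
  case False
  then obtain i' m' where im: "i = Suc i'" "m = Suc m'" by (metis not0_implies_Suc)
  let ?c = "\<lambda>r. qscale (coef_fps F (i' - r) (m' - r))"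
  have "(\<Sum>r\<le>min i m. kweight r * qscale (coef_fps F (i - r) (m - r)))
     = qscale (coef_fps F i m) + (\<Sum>r\<le>min i' m'. kweight (Suc r) * ?c r)"
    unfolding im min_Suc_Suc by (subst sum.atMost_Suc_shift) simp
  also have "(\<Sum>r\<le>min i' m'. kweight (Suc r) * ?c r)
     = (\<Sum>r\<le>min i' m'. qscale (kweight (Suc r)) * ?c r)
       - fps_const Q * fps_X * (\<Sum>r\<le>min i' m'. qscale (kweight r) * ?c r)"
    by (subst kweight_eq_qscale) (simp add: left_diff_distrib right_diff_distrib sum_subtractf sum_distrib_left mult_ac)
  also have "(\<Sum>r\<le>min i' m'. qscale (kweight r) * ?c r) = qscale (kernel F i' m')"
    by (simp add: kernel_def qscale_sum qscale_simps)
  also have "qscale (coef_fps F i m) + ((\<Sum>r\<le>min i' m'. qscale (kweight (Suc r)) * ?c r) - w)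
      = qscale (kernel F i m) - w" for w
    unfolding kernel_def im min_Suc_Suc
    by (subst sum.atMost_Suc_shift) (simp add: qscale_sum qscale_simps)
  finally show ?thesis by (simp add: im)
qed

lemma kernel_star_fps_box:
  "(1 - fps_X) * (1 - fps_const Q * fps_X) *
     (kernel (star_fps v) i m - qscale (kernel (star_fps v) i m)
      + fps_const Q * fps_X * (if i = 0 \<or> m = 0 then 0 else qscale (kernel (star_fps v) (i - 1) (m - 1))))
   = fps_X * (fps_const ((1 - Q)\<^sup>2) * kernel (star_fps (qbox q v)) i m)" (is "?p * ?l = _")
proof -
  let ?c = "\<lambda>r. coef_fps (star_fps v) (i - r) (m - r)"
  have "?l = kernel (star_fps v) i m - (\<Sum>r\<le>min i m. kweight r * qscale (?c r))"
    unfolding sum_kweight_qscale by simp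
  also have "\<dots> = (\<Sum>r\<le>min i m. kweight r * (?c r - qscale (?c r)))"
    by (simp add: kernel_def sum_subtractf right_diff_distrib)
  finally have "?p * ?l = (\<Sum>r\<le>min i m. kweight r * (?p * (?c r - qscale (?c r))))"
    by (simp only: sum_distrib_left mult_ac)
  also have "\<dots> = (\<Sum>r\<le>min i m. fps_X * (fps_const ((1 - Q)\<^sup>2)
      * (kweight r * coef_fps (star_fps (qbox q v)) (i - r) (m - r))))"
    unfolding coef_star_fps_qscale by (simp only: mult_ac)
  finally show ?thesis
    by (simp only: kernel_def sum_distrib_left)
qed

section \<open>Kernels of monomials and the initial value at t = 0\<close>

lemma lookup_mon: "Poly_Mapping.lookup (mon j k) x = (if (j, k) = x then 1 else 0)"
  by (auto simp: lookup_single when_def)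

lemma kernel0_lin:
  "kernel0 (f + g) i m = kernel0 f i m + kernel0 g i m"
  "kernel0 (scl c f) i m = c * kernel0 f i m"
  by (simp_all add: kernel0_def lookup_add sum.distrib distrib_left sum_distrib_left mult_ac)

lemma kernel_pol_lin:
  "kernel_pol (f + g) i m = kernel_pol f i m + kernel_pol g i m"
  "kernel_pol (scl c f) i m = fps_const c * kernel_pol f i m"
  by (simp_all add: kernel_pol_def lookup_add sum.distrib distrib_left sum_distrib_left mult_ac
      flip: fps_const_add fps_const_mult)

lemma kernel0_mon:
  "kernel0 (mon j k) i m = (if j \<le> i \<and> k \<le> m \<and> i - j = m - k then inverse (qfac (i - j)) else 0)"
  unfolding kernel0_def lookup_mon by (rule sum_diagonal_delta)

lemma kernel_pol_mon:
  "kernel_pol (mon j k) i m = (if j \<le> i \<and> k \<le> m \<and> i - j = m - k then kweight (i - j) else 0)"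
  unfolding kernel_pol_def lookup_mon if_distrib[of fps_const] fps_const_1_eq_1 fps_const_0_eq_0
  by (rule sum_diagonal_delta)

lemma kernel0_lmul_z:
  "kernel0 (lmul_z f) i m = (if i = 0 then 0 else kernel0 f (i - 1) m)"
proof (rule linear_to_mult_eqI[where x = f])
  fix k :: "nat \<times> nat"
  obtain a b where k: "k = (a, b)" by (cases k)
  show "kernel0 (lmul_z (bas k)) i m = (if i = 0 then 0 else kernel0 (bas k) (i - 1) m)"
    by (cases i) (simp_all add: k lmul_z_mon kernel0_mon)
qed (simp_all add: kernel0_lin lin_add[OF lin_lmul_z] lin_scl[OF lin_lmul_z])

text \<open>At t = 0 the operator z* sends e_(i+1) to (1 - Q^(i+1)) e_i, so row i of the product is
  a multiple of row i + 1.\<close>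

lemma kernel0_lmul_zs:
  "kernel0 (lmul_zs q f) i m = (1 - Q ^ Suc i) * kernel0 f (Suc i) m"
proof (rule linear_to_mult_eqI[where x = f])
  fix k :: "nat \<times> nat"
  obtain a b where k: "k = (a, b)" by (cases k)
  have c: "complex_of_real (1 - q ^ (2 * a)) = 1 - Q ^ a" "complex_of_real (q ^ (2 * a)) = Q ^ a"
    using of_real_q(2)[of a] by simp_all
  have *: "kernel0 (lmul_zs q (mon a b)) i m
     = Q ^ a * kernel0 (mon a (Suc b)) i m + (1 - Q ^ a) * kernel0 (mon (a - 1) b) i m"
    by (simp only: lmul_zs_mon kernel0_lin c)
  show "kernel0 (lmul_zs q (bas k)) i m = (1 - Q ^ Suc i) * kernel0 (bas k) (Suc i) m"
  proof (cases "a \<le> Suc i \<and> b \<le> m \<and> Suc i - a = m - b")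
    case True
    define r where "r = Suc i - a"
    have r: "Suc i = a + r" "m = b + r" using True by (auto simp: r_def)
    \<comment> \<open>For r = 0 only the second summand of \<open>*\<close> contributes; for r > 0
      both do, and Q^a (1 - Q^r) + 1 - Q^a = 1 - Q^(a+r).\<close>
    show ?thesis
    proof (cases r)
      case 0
      then have "a = Suc i" "b = m" using r by auto
      then show ?thesis unfolding k * by (simp add: kernel0_mon)
    next
      case (Suc s)
      then have i: "i = a + s" and m: "m = b + Suc s" using r by auto
      have nz: "1 - Q ^ Suc s \<noteq> 0" using Q_power_neq_1[of s] by simp
      have 1: "kernel0 (mon a (Suc b)) i m = inverse (qfac s)"
        by (simp add: kernel0_mon i m)
      have 2: "(1 - Q ^ a) * kernel0 (mon (a - 1) b) i m = (1 - Q ^ a) * inverse (qfac (Suc s))"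
        by (cases a) (simp_all add: kernel0_mon i m)
      have 3: "kernel0 (mon a b) (Suc i) m = inverse (qfac (Suc s))"
        by (simp add: kernel0_mon i m)
      have "Q ^ a * inverse (qfac s) = Q ^ a * (1 - Q ^ Suc s) * inverse (qfac (Suc s))"
        using nz by (simp add: qfac_Suc del: power_Suc)
      moreover have "Q ^ Suc i = Q ^ a * Q ^ Suc s" by (simp add: i power_add)
      ultimately show ?thesis
        unfolding k * 1 2 3 by (simp add: algebra_simps del: power_Suc)
    qed
  next
    case False
    then have n1: "\<not> (a \<le> i \<and> Suc b \<le> m \<and> i - a = m - Suc b)"
      and n2: "a \<noteq> 0 \<Longrightarrow> \<not> (a - 1 \<le> i \<and> b \<le> m \<and> i - (a - 1) = m - b)"
      by auto
    have "kernel0 (mon a (Suc b)) i m = 0" "kernel0 (mon a b) (Suc i) m = 0"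
      using n1 False by (simp_all only: kernel0_mon if_False)
    moreover have "(1 - Q ^ a) * kernel0 (mon (a - 1) b) i m = 0"
    proof (cases "a = 0")
      case False
      then show ?thesis using n2[OF False] by (simp only: kernel0_mon if_False mult_zero_right)
    qed simp
    ultimately show ?thesis
      unfolding k * by simp
  qed
qed (simp_all add: kernel0_lin lin_add[OF lin_lmul_zs] lin_scl[OF lin_lmul_zs] algebra_simps)

text \<open>The b factors z* contribute a quotient of two \<open>qfac\<close>, and the factors z
  shift the row. The result is \<open>ker_prod\<close> at t = 0.\<close>

lemma kernel0_pmul_mon:
  "kernel0 (pmul q (mon a b) (mon c d)) i m = (if a \<le> i \<and> d \<le> m \<and> i - a + b = m - d + c
     then qfac (i - a + b) / (qfac (i - a) * qfac (m - d)) else 0)"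
proof -
  have zs: "kernel0 ((lmul_zs q ^^ b) (mon c d)) i m
    = (if d \<le> m \<and> i + b = m - d + c then qfac (i + b) / (qfac i * qfac (m - d)) else 0)" for i
  proof (induction b arbitrary: i)
    case 0
    have "c \<le> i \<and> d \<le> m \<and> i - c = m - d \<longleftrightarrow> d \<le> m \<and> i = m - d + c" by auto
    then show ?case by (auto simp: kernel0_mon divide_inverse)
  next
    case (Suc b)
    have "1 - Q ^ Suc i \<noteq> 0" using Q_power_neq_1[of i] by simp
    then show ?case
      by (simp add: kernel0_lmul_zs Suc qfac_Suc[of i] del: power_Suc)
  qed
  have "kernel0 ((lmul_z ^^ a) f) i m = (if a \<le> i then kernel0 f (i - a) m else 0)" for f i
    by (induction a arbitrary: i) (auto simp: kernel0_lmul_z)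
  then show ?thesis by (simp add: pmul_mon zs)
qed

lemma kernel_star_fps_nth_0: "kernel (star_fps v) i m $ 0 = kernel0 (m0 q v) i m"
  by (simp add: kernel_def kernel0_def fps_nth_sum coef_fps_def star_fps_def star_op_0 kweight_nth_0)

text \<open>Both sides satisfy the same difference equation and agree at t = 0. For n > 0 the
  equation expresses 1 - Q^n times coefficient n of their difference through lower coefficients, so
  all vanish.\<close>

theorem kernel_star_fps_bas:
  "kernel (star_fps (bas ((a, b), (c, d)))) i m = ker_prod a b c d i m"
proof -
  define Y where "Y b c = kernel (star_fps (bas ((a, b), (c, d))))" for b c
  define D where "D b c i m = Y b c i m - ker_prod a b c d i m" for b c i m
  have "D b c i m $ n = 0" for b c i m n
  \<comment> \<open>The equation shifts b, c, i and m, so these must vary in the induction.\<close>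
  proof (induction n arbitrary: b c i m rule: less_induct)
    case (less n)
    show ?case
    proof (cases "n = 0")
      case True
      have "Y b c i m $ 0 = kernel0 (pmul q (mon a b) (mon c d)) i m"
        by (simp add: Y_def kernel_star_fps_nth_0 m0_def)
      then show ?thesis
        by (simp add: True D_def ker_prod_nth_0 kernel0_pmul_mon)
    next
      case False
      let ?K = "fps_const ((1 - Q)\<^sup>2 * (qint b * qint c / Q))"
      let ?t = "fps_const Q * fps_X * (if i = 0 \<or> m = 0 then 0 else qscale (D b c (i - 1) (m - 1)))"
      let ?f = "D b c i m - qscale (D b c i m) + ?t"
      let ?g = "?K * (D (b - 1) (c - 1) i m - fps_const (1 + 1 / Q) * D b c i m + fps_const (1 / Q) * D (Suc b) (Suc c) i m)"
      have "(1 - fps_X) * (1 - fps_const Q * fps_X) *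
         (Y b c i m - qscale (Y b c i m)
          + fps_const Q * fps_X * (if i = 0 \<or> m = 0 then 0 else qscale (Y b c (i - 1) (m - 1))))
       = fps_X * (?K * (Y (b - 1) (c - 1) i m - fps_const (1 + 1 / Q) * Y b c i m + fps_const (1 / Q) * Y (Suc b) (Suc c) i m))"
        unfolding Y_def kernel_star_fps_box qbox_bas kernel_star_fps kernel_star_fps_diff fps_const_mult[symmetric]
        by (simp only: mult.assoc)
      note eq = arg_cong2[where f = minus, OF this ker_prod_box[of a b c d i m]]
      have "(1 - fps_X) * (1 - fps_const Q * fps_X) * ?f = fps_X * ?g"
        using eq unfolding right_diff_distrib[symmetric]
        by (auto simp: D_def qscale_simps algebra_simps split: if_splits)
      then have f0: "?f $ n = 0"
      proof (rule fps_nth_eq_0_of_shift)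
        fix l assume l: "l < n"
        show "?f $ l = 0" using l less by (auto simp: mult.assoc)
        show "?g $ l = 0" using l less by simp
      qed (use False in simp)
      \<comment> \<open>Because of the factor t only coefficient n - 1 of the predecessor
        enters.\<close>
      have "?t $ n = 0"
        using False less[of "n - 1"] by (auto simp: mult.assoc)
      then have "(1 - Q ^ n) * D b c i m $ n = 0"
        using f0 by (simp add: algebra_simps)
      moreover have "1 - Q ^ n \<noteq> 0"
        using False Q_power_neq_1[of "n - 1"] by simp
      ultimately show ?thesis by simp
    qed
  qed
  then have "D b c i m = 0" by (simp add: fps_eq_iff)
  then show ?thesis by (simp add: D_def Y_def)
qed

section \<open>Star multiplication by monomials, and associativity for polynomials\<close>

lemma kernel_star_lin:
  "kernel (star q (f + f') g) i m = kernel (star q f g) i m + kernel (star q f' g) i m"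
  "kernel (star q (scl x f) g) i m = fps_const x * kernel (star q f g) i m"
  "kernel (star q f (g + g')) i m = kernel (star q f g) i m + kernel (star q f g') i m"
  "kernel (star q f (scl x g)) i m = fps_const x * kernel (star q f g) i m"
  by (simp_all only: star_eq_star_fps lin_add[OF lin_tens_left] lin_scl[OF lin_tens_left]
      lin_add[OF lin_tens_right] lin_scl[OF lin_tens_right] kernel_star_fps)

lemma kernel_star_mon: "kernel (star q (mon a b) (mon c d)) i m = ker_prod a b c d i m"
  by (simp add: star_eq_star_fps kernel_star_fps_bas)

text \<open>The kernel of z^c z*^d has at most one nonzero entry in column m, so the product sees
  only column m - d + c of the kernel of f.\<close>

lemma kernel_star_right:
  "kernel (star q f (mon c d)) i m =
    (if d \<le> m then kweight (m - d) * inv_kweight (m - d + c) * kernel_pol f i (m - d + c) else 0)"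
proof (rule linear_to_fps_eqI[where x = f])
  fix k :: "nat \<times> nat"
  obtain a b where k: "k = (a, b)" by (cases k)
  have iff: "a \<le> i \<and> b \<le> m - d + c \<and> i - a = m - d + c - b \<longleftrightarrow> a \<le> i \<and> i - a + b = m - d + c" by auto
  show "kernel (star q (bas k) (mon c d)) i m =
    (if d \<le> m then kweight (m - d) * inv_kweight (m - d + c) * kernel_pol (bas k) i (m - d + c) else 0)"
    unfolding k kernel_star_mon kernel_pol_mon iff ker_prod_def
    by (cases "d \<le> m"; cases "a \<le> i \<and> i - a + b = m - d + c")
       (simp_all only: simp_thms if_True if_False diff_add_inverse2 mult_ac mult_zero_left mult_zero_right)
qed (simp_all add: kernel_star_lin kernel_pol_lin algebra_simps)

lemma kernel_star_left:
  "kernel (star q (mon a b) g) i m =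
    (if a \<le> i then kweight (i - a) * inv_kweight (i - a + b) * kernel_pol g (i - a + b) m else 0)"
proof (rule linear_to_fps_eqI[where x = g])
  fix k :: "nat \<times> nat"
  obtain c d where k: "k = (c, d)" by (cases k)
  have iff: "c \<le> i - a + b \<and> d \<le> m \<and> i - a + b - c = m - d \<longleftrightarrow> d \<le> m \<and> i - a + b = m - d + c" by auto
  show "kernel (star q (mon a b) (bas k)) i m =
    (if a \<le> i then kweight (i - a) * inv_kweight (i - a + b) * kernel_pol (bas k) (i - a + b) m else 0)"
    unfolding k kernel_star_mon kernel_pol_mon iff ker_prod_def
    by (cases "a \<le> i"; cases "d \<le> m \<and> i - a + b = m - d + c")
       (simp_all only: simp_thms if_True if_False diff_add_inverse2 mult_ac mult_zero_left mult_zero_right)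
qed (simp_all add: kernel_star_lin kernel_pol_lin algebra_simps)

text \<open>The star product extended t-adically in its first argument, as iterated products
  require.\<close>

definition star_right :: "pol fps \<Rightarrow> pol \<Rightarrow> pol fps" where
  "star_right F h = adic_sum (\<lambda>k. star q (F $ k) h)"

definition star_left :: "pol \<Rightarrow> pol fps \<Rightarrow> pol fps" where
  "star_left f G = adic_sum (\<lambda>k. star q f (G $ k))"

lemma coef_fps_adic_sum: "coef_fps (adic_sum A) i m = adic_sum (\<lambda>k. coef_fps (A k) i m)"
  by (simp add: coef_fps_def adic_sum_def fps_eq_iff lookup_sum)

lemma kernel_adic_sum: "kernel (adic_sum A) i m = adic_sum (\<lambda>k. kernel (A k) i m)"
  by (simp add: kernel_def coef_fps_adic_sum adic_sum_sum adic_sum_mult)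

text \<open>Reduces kernels of series to those of their coefficients, so the formulas for
  polynomials carry over.\<close>

lemma kernel_eq_adic_sum: "kernel F i m = adic_sum (\<lambda>k. kernel_pol (F $ k) i m)"
  by (simp add: kernel_def kernel_pol_def adic_sum_sum adic_sum_mult adic_sum_const coef_fps_def)

lemma kernel_star_right_mon:
  "kernel (star_right F (mon c d)) i m =
    (if d \<le> m then kweight (m - d) * inv_kweight (m - d + c) * kernel F i (m - d + c) else 0)"
  by (simp add: star_right_def kernel_adic_sum kernel_star_right adic_sum_mult adic_sum_0 kernel_eq_adic_sum[of F])

lemma kernel_star_left_mon:
  "kernel (star_left (mon a b) G) i m =
    (if a \<le> i then kweight (i - a) * inv_kweight (i - a + b) * kernel G (i - a + b) m else 0)"
  by (simp add: star_left_def kernel_adic_sum kernel_star_left adic_sum_mult adic_sum_0 kernel_eq_adic_sum[of G])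

text \<open>With monomials on both sides only one intermediate index contributes to each matrix product,
  so no infinite sum of matrix entries ever occurs.\<close>
lemma star_assoc_mon:
  "star_right (star q (mon a b) g) (mon c d) = star_left (mon a b) (star q g (mon c d))"
  by (rule kernel_inject) (simp add: kernel_star_right_mon kernel_star_left_mon kernel_star_left kernel_star_right)

text \<open>Linearity in f and h reduces the outer arguments to monomials; the middle one is already
  arbitrary in \<open>star_assoc_mon\<close>.\<close>

lemma star_assoc: "star_right (star q f g) h $ n = star_left f (star q g h) $ n"
proof -
  have R: "star_right (star q f g) h $ n = (\<Sum>k\<le>n. star q (star q f g $ k) h $ (n - k))" for f h
    by (simp add: star_right_def adic_sum_def)
  have L: "star_left f (star q g h) $ n = (\<Sum>k\<le>n. star q f (star q g h $ k) $ (n - k))" for f h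
    by (simp add: star_left_def adic_sum_def)
  have lf: "lin (\<lambda>f. star_right (star q f g) h $ n)" "lin (\<lambda>f. star_left f (star q g h) $ n)" for h
    unfolding R L
    by (intro lin_sum lin_comp[OF lin_star_nth(1) lin_star_nth(1)] lin_star_nth(1))+
  have lh: "lin (\<lambda>h. star_right (star q f g) h $ n)" "lin (\<lambda>h. star_left f (star q g h) $ n)" for f
    unfolding R L
    by (intro lin_sum lin_comp[OF lin_star_nth(2) lin_star_nth(2)] lin_star_nth(2))+
  show ?thesis
  proof (rule lin_eqI[OF lf])
    fix k :: "nat \<times> nat"
    show "star_right (star q (bas k) g) h $ n = star_left (bas k) (star q g h) $ n"
      by (rule lin_eqI[OF lh]) (metis star_assoc_mon surj_pair)
  qed
qed

lemma star_nth_assoc: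
  "(\<Sum>k\<le>n. star q (star q f g $ k) h $ (n - k)) = (\<Sum>k\<le>n. star q f (star q g h $ k) $ (n - k))"
  using star_assoc[of f g h n] by (simp add: star_right_def star_left_def adic_sum_def)

section \<open>Associativity for power series in t\<close>

lemma star_nth_sum:
  "star q (\<Sum>i\<in>I. f i) h $ n = (\<Sum>i\<in>I. star q (f i) h $ n)"
  "star q h (\<Sum>i\<in>I. f i) $ n = (\<Sum>i\<in>I. star q h (f i) $ n)"
proof -
  have "star q 0 h $ n = 0" "star q h 0 $ n = 0"
    using lin_scl[OF lin_star_nth(1)[of q h n], of 0 0] lin_scl[OF lin_star_nth(2)[of q h n], of 0 0]
    by (simp_all add: scl_rules)
  then show "star q (\<Sum>i\<in>I. f i) h $ n = (\<Sum>i\<in>I. star q (f i) h $ n)"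
    "star q h (\<Sum>i\<in>I. f i) $ n = (\<Sum>i\<in>I. star q h (f i) $ n)"
    by (induction I rule: infinite_finite_induct)
       (simp_all add: lin_add[OF lin_star_nth(1)] lin_add[OF lin_star_nth(2)])
qed

lemma star_mult_nth_flat:
  "star_mult q F G $ n = (\<Sum>(x, y)\<in>{(x, y). x + y \<le> n}. star q (F $ x) (G $ y) $ (n - (x + y)))"
proof -
  have "star_mult q F G $ n = (\<Sum>(i, j)\<in>(SIGMA i:{..n}. {..i}). star q (F $ j) (G $ (i - j)) $ (n - i))"
    unfolding star_mult_nth by (rule sum.Sigma) auto
  also have "\<dots> = (\<Sum>(x, y)\<in>{(x, y). x + y \<le> n}. star q (F $ x) (G $ y) $ (n - (x + y)))"
    by (rule sum.reindex_bij_witness[of _ "\<lambda>(x, y). (x + y, x)" "\<lambda>(i, j). (j, i - j)"]) auto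
  finally show ?thesis .
qed

lemma finite_pairs: "finite {(x, y). x + y \<le> (n :: nat)}"
  by (rule finite_subset[of _ "{..n} \<times> {..n}"]) auto

theorem star_mult_assoc: "star_mult q (star_mult q F G) H = star_mult q F (star_mult q G H)"
proof (rule fps_ext)
  fix n :: nat
  \<comment> \<open>Here x, y, z are the powers of t taken from F, G, H and k is the power produced
    by the inner star product; the outer one supplies the rest.\<close>
  let ?T = "SIGMA (x, y, z):{(x, y, z). x + y + z \<le> n}. {..n - (x + y + z)}"
  have fin: "finite {(x, y, z). x + y + z \<le> n}"
    by (rule finite_subset[of _ "{..n} \<times> {..n} \<times> {..n}"]) auto
  have "star_mult q (star_mult q F G) H $ n
     = (\<Sum>(p, (x, y))\<in>(SIGMA p:{(s, z). s + z \<le> n}. {(x, y). x + y \<le> fst p}).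
          star q (star q (F $ x) (G $ y) $ (fst p - (x + y))) (H $ snd p) $ (n - (fst p + snd p)))"
    by (subst star_mult_nth_flat, subst sum.Sigma[symmetric])
       (auto simp: finite_pairs star_mult_nth_flat[of F G] star_nth_sum case_prod_beta)
  \<comment> \<open>The degree s of the inner product is x + y + k.\<close>
  also have "\<dots> = (\<Sum>((x, y, z), k)\<in>?T. star q (star q (F $ x) (G $ y) $ k) (H $ z) $ (n - (x + y + z) - k))"
    by (rule sum.reindex_bij_witness[of _ "\<lambda>((x, y, z), k). ((x + y + k, z), (x, y))"
          "\<lambda>((s, z), (x, y)). ((x, y, z), s - (x + y))"]) (auto simp: algebra_simps)
  also have "\<dots> = (\<Sum>(x, y, z)\<in>{(x, y, z). x + y + z \<le> n}. \<Sum>k\<le>n - (x + y + z).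
       star q (star q (F $ x) (G $ y) $ k) (H $ z) $ (n - (x + y + z) - k))"
    by (subst sum.Sigma[symmetric]) (auto simp: fin case_prod_beta)
  also have "\<dots> = (\<Sum>(x, y, z)\<in>{(x, y, z). x + y + z \<le> n}. \<Sum>k\<le>n - (x + y + z).
       star q (F $ x) (star q (G $ y) (H $ z) $ k) $ (n - (x + y + z) - k))"
    by (simp only: star_nth_assoc)
  also have "\<dots> = (\<Sum>((x, y, z), k)\<in>?T. star q (F $ x) (star q (G $ y) (H $ z) $ k) $ (n - (x + y + z) - k))"
    by (subst sum.Sigma[symmetric]) (auto simp: fin case_prod_beta)
  also have "\<dots> = (\<Sum>(p, (y, z))\<in>(SIGMA p:{(x, s). x + s \<le> n}. {(y, z). y + z \<le> snd p}).
          star q (F $ fst p) (star q (G $ y) (H $ z) $ (snd p - (y + z))) $ (n - (fst p + snd p)))"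
    by (rule sum.reindex_bij_witness[symmetric, of _ "\<lambda>((x, y, z), k). ((x, y + z + k), (y, z))"
          "\<lambda>((x, s), (y, z)). ((x, y, z), s - (y + z))"]) (auto simp: algebra_simps)
  also have "\<dots> = star_mult q F (star_mult q G H) $ n"
    by (subst star_mult_nth_flat, subst sum.Sigma[symmetric])
       (auto simp: finite_pairs star_mult_nth_flat[of G H] star_nth_sum case_prod_beta)
  finally show "star_mult q (star_mult q F G) H $ n = star_mult q F (star_mult q G H) $ n" .
qed

end

theorem proposition5p1:
  fixes q :: real
  assumes "0 < q" and "q < 1"
  shows "\<forall>F G H :: pol fps. star_mult q (star_mult q F G) H = star_mult q F (star_mult q G H)"
  using quantum_disc.star_mult_assoc[OF quantum_disc.intro[OF assms]] by blast

end
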